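(* There exist computable rational sequences ("clocks") $\boldsymbol a^{(1)},\boldsymbol a^{(2)}$, each with entries in a compact subinterval of $(1/2,1)$, such that, with $X=\log_2\varepsilon^{-1}$, the associated chronological radii satisfy $$\rho_{\rm ch}^{(1)}=\rho_{\rm ch}^{(2)}=\frac9{10},$$ but $$\lim_{\varepsilon\downarrow0}\frac{H_\varepsilon(\mathcal C_{\boldsymbol a^{(1)}})}{X^2}=\frac1{2\log_2(10/9)}\ \neq\ \frac1{2\log_2(5/3)}=\lim_{\varepsilon\downarrow0}\frac{H_\varepsilon(\mathcal C_{\boldsymbol a^{(2)}})}{X^2}.$$
   Context: Given a clock $\boldsymbol a=(a_k)_{k\ge1}$ with $1/2<\underline a\le a_k\le\overline a<1$, and $t=(t_k)_{k\ge1}\in[0,1]^{\mathbb N}$, consider the two-channel masks $$A_0^{[k]}=\begin{pmatrix}a_k&0\\0&1/2\end{pmatrix},\quad A_1^{[k]}=\begin{pmatrix}0&0\\0&1\end{pmatrix},\quad A_2^{[k]}=\begin{pmatrix}0&t_k\\0&1/2\end{pmatrix},$$ with $A_j^{[k]}=0$ for $j\notin\{0,1,2\}$. Function class. $h(x)=\max\{1-|x-1|,0\}$, $w_k=\prod_{i=1}^{k-1}a_i$, $\phi_t(x)=\sum_{k\ge1}w_kt_kh(2^kx-2)$, and $\mathcal C_{\boldsymbol a}=\{\phi_t:t\in[0,1]^{\mathbb N}\}$. (The first component of the limit of the cascade $V_1\cdots V_n(0,h)^T$, $(V_kf)(x)=\sum_jA^{[k]}_jf(2x-j)$, is $\phi_t$.)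 Chronological radius. For $\epsilon\in\{0,1\}$ let $T^{[k]}_\epsilon\in\mathbb R^{4\times4}$ have $2\times2$ blocks $[T^{[k]}_\epsilon]_{i\ell}=A^{[k]}_{2i-\ell-1+\epsilon}$, $i,\ell\in\{1,2\}$. Let $P=(0,1,0,1)$, let $U$ have columns forming an orthonormal basis of $\ker P\subset\mathbb R^4$, and $C_{k,\epsilon}=U^TT_\epsilon^{[k]}U$. Then $\rho_{\rm ch}=\lim_{m\to\infty}\chi_m^{1/m}$ with $\chi_m=\sup_{b\ge1}\max_{\epsilon_b,\dots,\epsilon_{b+m-1}\in\{0,1\}}\|C_{b,\epsilon_b}\cdots C_{b+m-1,\epsilon_{b+m-1}}\|$; its value depends only on $\boldsymbol a$, not on $t$. Entropy. $N(\varepsilon,\mathcal C)$ is the minimal number of closed uniform-norm balls of radius $\varepsilon$, with arbitrary bounded functions on $\mathbb R$ as centers, covering $\mathcal C$, and $H_\varepsilon(\mathcal C)=\log_2N(\varepsilon,\mathcal C)$. *)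

theory Defs
  imports "HOL-Analysis.Analysis"
begin

text \<open>
  All sequences \<open>a\<close>, \<open>t\<close> of the paper are indexed by \<open>k \<ge> 1\<close>; the value at index \<open>0\<close> is never used.
\<close>

text \<open>
  Total recursive functions of arity \<open>n\<close>: the closure of the zero functions, successor and projections
  under composition, primitive recursion, and minimisation of regular functions. Only the
  values on argument lists of length \<open>n\<close> are meaningful.
\<close>

inductive total_recursive :: "nat \<Rightarrow> (nat list \<Rightarrow> nat) \<Rightarrow> bool" where
  zero: "total_recursive n (\<lambda>xs. 0)"
| succ: "total_recursive 1 (\<lambda>xs. Suc (hd xs))"
| proj: "i < n \<Longrightarrow> total_recursive n (\<lambda>xs. xs ! i)"
| comp: "total_recursive (length gs) f \<Longrightarrow> (\<forall>g\<in>set gs. total_recursive n g)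
    \<Longrightarrow> total_recursive n (\<lambda>xs. f (map (\<lambda>g. g xs) gs))"
| prim_rec: "total_recursive n f \<Longrightarrow> total_recursive (Suc (Suc n)) g
    \<Longrightarrow> total_recursive (Suc n)
          (\<lambda>xs. rec_nat (f (tl xs)) (\<lambda>m r. g (m # r # tl xs)) (hd xs))"
| minim: "total_recursive (Suc n) f \<Longrightarrow> (\<forall>xs. length xs = n \<longrightarrow> (\<exists>y. f (y # xs) = 0))
    \<Longrightarrow> total_recursive n (\<lambda>xs. LEAST y. f (y # xs) = 0)"

definition computable_rat_seq :: "(nat \<Rightarrow> rat) \<Rightarrow> bool" where
  "computable_rat_seq a \<longleftrightarrow>
    (\<exists>s p q. total_recursive 1 s \<and> total_recursive 1 p \<and> total_recursive 1 q \<and>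
      (\<forall>k\<ge>1. q [k] \<noteq> 0 \<and> a k = (-1) ^ s [k] * of_nat (p [k]) / of_nat (q [k])))"

definition mask :: "(nat \<Rightarrow> real) \<Rightarrow> (nat \<Rightarrow> real) \<Rightarrow> nat \<Rightarrow> int \<Rightarrow> real ^ 2 ^ 2" where
  "mask a t k j =
    (if j = 0 then vector [vector [a k, 0], vector [0, 1 / 2]]
     else if j = 1 then vector [vector [0, 0], vector [0, 1]]
     else if j = 2 then vector [vector [0, t k], vector [0, 1 / 2]]
     else 0)"

text \<open>
  Coordinates of \<open>\<real>\<^sup>4\<close> grouped in two blocks of two: the coordinates \<open>1, 2, 3, 4\<close> are the
  pairs (block, position in the block) \<open>(1,1), (1,2), (2,1), (2,2)\<close>.
\<close>

definition block_of :: "4 \<Rightarrow> int" where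
  "block_of r = (if r \<in> {1, 2} then 1 else 2)"

definition pos_of :: "4 \<Rightarrow> 2" where
  "pos_of r = (if r \<in> {1, 3} then 1 else 2)"

definition T_mat :: "(nat \<Rightarrow> real) \<Rightarrow> (nat \<Rightarrow> real) \<Rightarrow> nat \<Rightarrow> int \<Rightarrow> real ^ 4 ^ 4" where
  "T_mat a t k \<epsilon> =
    (\<chi> r c. mask a t k (2 * block_of r - block_of c - 1 + \<epsilon>) $ pos_of r $ pos_of c)"

definition P_vec :: "real ^ 4" where
  "P_vec = (\<chi> r. if r \<in> {2, 4} then 1 else 0)"

definition onb_ker_P :: "real ^ 3 ^ 4 \<Rightarrow> bool" where
  "onb_ker_P U \<longleftrightarrow>
    (\<forall>j. norm (column j U) = 1) \<and>
    (\<forall>i j. i \<noteq> j \<longrightarrow> orthogonal (column i U) (column j U)) \<and>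
    span (columns U) = {x. P_vec \<bullet> x = 0}"

lemma ex_onb_ker_P: "\<exists>U. onb_ker_P U"
proof -
  define s :: real where "s = 1 / sqrt 2"
  have s2: "s * s = 1 / 2" by (simp add: s_def)
  define c :: "3 \<Rightarrow> real ^ 4" where
    "c j = (if j = 1 then axis 1 1 else if j = 2 then s *\<^sub>R (axis 2 1 - axis 4 1) else axis 3 1)" for j
  define U :: "real ^ 3 ^ 4" where "U = (\<chi> r j. c j $ r)"
  have col: "column j U = c j" for j
    by (simp add: U_def column_def vec_eq_iff)
  have n4: "(1::4) \<noteq> 2" "(1::4) \<noteq> 3" "(1::4) \<noteq> 4" "(2::4) \<noteq> 3" "(2::4) \<noteq> 4" "(3::4) \<noteq> 4"
    by simp_all
  note n4s = n4 n4[symmetric]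
  have c1: "c 1 = axis 1 1" and c2: "c 2 = s *\<^sub>R (axis 2 1 - axis 4 1)" and c3: "c 3 = axis 3 1"
    by (simp_all add: c_def)
  have cols: "columns U = {c 1, c 2, c 3}"
    unfolding columns_def col by (auto, metis exhaust_3)
  have nrm: "norm (c j) = 1" for j
    using exhaust_3[of j] s2 n4s
    by (auto simp: c1 c2 c3 norm_eq_1 inner_vec_def sum_4 axis_def)
  have orth: "orthogonal (c i) (c j)" if "i \<noteq> j" for i j
    using exhaust_3[of i] exhaust_3[of j] that n4s
    by (auto simp: c1 c2 c3 orthogonal_def inner_vec_def sum_4 axis_def)
  have P: "P_vec \<bullet> x = x $ 2 + x $ 4" for x
    using n4s by (simp add: P_vec_def inner_vec_def sum_4)
  have "span (columns U) = {x. P_vec \<bullet> x = 0}"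
  proof
    have "columns U \<subseteq> {x. P_vec \<bullet> x = 0}"
      using n4s by (auto simp: cols P c1 c2 c3 axis_def)
    moreover have "subspace {x. P_vec \<bullet> x = 0}"
      by (rule subspace_hyperplane)
    ultimately show "span (columns U) \<subseteq> {x. P_vec \<bullet> x = 0}"
      by (rule span_minimal)
    show "{x. P_vec \<bullet> x = 0} \<subseteq> span (columns U)"
    proof
      fix x assume "x \<in> {x. P_vec \<bullet> x = 0}"
      then have x4: "x $ 4 = - x $ 2" by (simp add: P)
      have "x = x $ 1 *\<^sub>R c 1 + (2 * s * x $ 2) *\<^sub>R c 2 + x $ 3 *\<^sub>R c 3"
        using s2 n4s by (simp add: vec_eq_iff forall_4 c1 c2 c3 axis_def x4)
      also have "\<dots> \<in> span (columns U)"
        unfolding cols by (intro span_add span_scale span_base) auto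
      finally show "x \<in> span (columns U)" .
    qed
  qed
  then have "onb_ker_P U"
    using nrm orth by (simp add: onb_ker_P_def col)
  then show ?thesis ..
qed

definition C_mat :: "real ^ 3 ^ 4 \<Rightarrow> (nat \<Rightarrow> real) \<Rightarrow> (nat \<Rightarrow> real) \<Rightarrow> nat \<Rightarrow> int \<Rightarrow> real ^ 3 ^ 3" where
  "C_mat U a t k \<epsilon> = transpose U ** T_mat a t k \<epsilon> ** U"

fun C_prod :: "real ^ 3 ^ 4 \<Rightarrow> (nat \<Rightarrow> real) \<Rightarrow> (nat \<Rightarrow> real) \<Rightarrow> nat \<Rightarrow> int list \<Rightarrow> real ^ 3 ^ 3" where
  "C_prod U a t b [] = mat 1"
| "C_prod U a t b (\<epsilon> # \<epsilon>s) = C_mat U a t b \<epsilon> ** C_prod U a t (Suc b) \<epsilon>s"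

definition chi :: "real ^ 3 ^ 4 \<Rightarrow> (nat \<Rightarrow> real) \<Rightarrow> (nat \<Rightarrow> real) \<Rightarrow> nat \<Rightarrow> real" where
  "chi U a t m =
    (SUP b\<in>{1..}. Max ((\<lambda>\<epsilon>s. onorm ((*v) (C_prod U a t b \<epsilon>s))) `
                        {\<epsilon>s. length \<epsilon>s = m \<and> set \<epsilon>s \<subseteq> {0, 1}}))"

text \<open>
  The radius depends neither on \<open>t\<close> nor on the choice of the orthonormal basis; a clock \<open>a\<close> has
  radius \<open>\<rho>\<close> if the limit exists and equals \<open>\<rho>\<close> for every admissible \<open>t\<close> and every basis.
\<close>

definition has_chronological_radius :: "(nat \<Rightarrow> real) \<Rightarrow> real \<Rightarrow> bool" where
  "has_chronological_radius a \<rho> \<longleftrightarrow>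
    (\<forall>t U. (\<forall>k\<ge>1. t k \<in> {0..1}) \<longrightarrow> onb_ker_P U \<longrightarrow>
      (\<lambda>m. root m (chi U a t m)) \<longlonglongrightarrow> \<rho>)"

definition hat :: "real \<Rightarrow> real" where
  "hat x = max (1 - \<bar>x - 1\<bar>) 0"

definition weight :: "(nat \<Rightarrow> real) \<Rightarrow> nat \<Rightarrow> real" where
  "weight a k = (\<Prod>i\<in>{1..<k}. a i)"

definition phi :: "(nat \<Rightarrow> real) \<Rightarrow> (nat \<Rightarrow> real) \<Rightarrow> real \<Rightarrow> real" where
  "phi a t x = (\<Sum>k. weight a (Suc k) * t (Suc k) * hat (2 ^ Suc k * x - 2))"

definition function_class :: "(nat \<Rightarrow> real) \<Rightarrow> (real \<Rightarrow> real) set" where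
  "function_class a = {phi a t | t. \<forall>k\<ge>1. t k \<in> {0..1}}"

definition covering_number :: "real \<Rightarrow> (real \<Rightarrow> real) set \<Rightarrow> nat" where
  "covering_number \<epsilon> \<F> =
    (LEAST n. \<exists>G. finite G \<and> card G = n \<and> (\<forall>g\<in>G. bounded (range g)) \<and>
      (\<forall>f\<in>\<F>. \<exists>g\<in>G. \<forall>x. \<bar>f x - g x\<bar> \<le> \<epsilon>))"

definition entropy :: "real \<Rightarrow> (real \<Rightarrow> real) set \<Rightarrow> real" where
  "entropy \<epsilon> \<F> = log 2 (real (covering_number \<epsilon> \<F>))"

end

theory Submission
  imports Defs "HOL-Library.Discrete_Functions" "HOL-Real_Asymp.Real_Asymp"
begin

text \<open>
  On \<open>ker P\<close>, with coordinates \<open>x\<^sub>1, x\<^sub>2, x\<^sub>3\<close>, the transition matrices act by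
  \<open>(a x\<^sub>1, x\<^sub>2 / 2, t x\<^sub>2)\<close> and \<open>(a x\<^sub>3, x\<^sub>2 / 2, - t x\<^sub>2)\<close>. If \<open>a \<le> 9 / 10\<close>, products of length \<open>m\<close> are
  \<open>O((9/10)\<^sup>m)\<close>, and if \<open>a = 9 / 10\<close> on arbitrarily long runs, this is attained up to a constant, so
  the radius is \<open>9 / 10\<close> however rare the runs are.

  The bumps of \<open>phi\<close> have disjoint supports, so the class is isometric to the box with sides
  \<open>[0, w\<^sub>k]\<close> in the maximum norm, and the entropy is the sum of \<open>log\<^sub>2 (w\<^sub>k / \<epsilon>)\<close> over \<open>w\<^sub>k \<ge> \<epsilon>\<close> up to
  a bounded error per term. It therefore sees only the mean \<open>c\<close> of \<open>- log\<^sub>2 a\<^sub>k\<close>, and its leading term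
  is \<open>X\<^sup>2 / (2 c)\<close>. The constant clock \<open>9 / 10\<close> and a clock equal to \<open>3 / 5\<close> except on long runs of density
  zero thus have the same radius and different entropies.
\<close>

subsection \<open>Closure properties of recursive functions\<close>

text \<open>\<open>total_recursive\<close> speaks of a function on all lists, while only lists of
  length \<open>n\<close> matter. Closing it under agreement on those lists lets each closure rule
  below be stated for a convenient lambda term.\<close>

definition computes :: "nat \<Rightarrow> (nat list \<Rightarrow> nat) \<Rightarrow> bool" where
  "computes n F \<longleftrightarrow> (\<exists>f. total_recursive n f \<and> (\<forall>xs. length xs = n \<longrightarrow> f xs = F xs))"

lemma computes_cong:
  assumes "computes n F" and "\<And>xs. length xs = n \<Longrightarrow> F xs = G xs"
  shows "computes n G"
  using assms unfolding computes_def by auto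

lemma computes_proj: "i < n \<Longrightarrow> computes n (\<lambda>xs. xs ! i)"
  unfolding computes_def using total_recursive.proj by blast

lemma computes_comp1:
  assumes "computes 1 F" "computes n G"
  shows "computes n (\<lambda>xs. F [G xs])"
proof -
  obtain f g where f: "total_recursive 1 f" "\<And>xs. length xs = 1 \<Longrightarrow> f xs = F xs"
    and g: "total_recursive n g" "\<And>xs. length xs = n \<Longrightarrow> g xs = G xs"
    using assms unfolding computes_def by blast
  have "total_recursive n (\<lambda>xs. f (map (\<lambda>g. g xs) [g]))"
    using f g by (intro total_recursive.comp) auto
  then show ?thesis
    unfolding computes_def using f(2) g(2) by (intro exI conjI) auto
qed

lemma computes_comp2:
  assumes "computes 2 F" "computes n G" "computes n H"
  shows "computes n (\<lambda>xs. F [G xs, H xs])"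
proof -
  obtain f g h where f: "total_recursive 2 f" "\<And>xs. length xs = 2 \<Longrightarrow> f xs = F xs"
    and g: "total_recursive n g" "\<And>xs. length xs = n \<Longrightarrow> g xs = G xs"
    and h: "total_recursive n h" "\<And>xs. length xs = n \<Longrightarrow> h xs = H xs"
    using assms unfolding computes_def by blast
  have "total_recursive n (\<lambda>xs. f (map (\<lambda>g. g xs) [g, h]))"
    using f g h by (intro total_recursive.comp) (auto simp: numeral_2_eq_2)
  then show ?thesis
    unfolding computes_def using f(2) g(2) h(2) by (intro exI conjI) auto
qed

lemma computes_Suc:
  assumes "computes n F" shows "computes n (\<lambda>xs. Suc (F xs))"
proof -
  have "computes 1 (\<lambda>xs. Suc (hd xs))"
    unfolding computes_def using total_recursive.succ by blast
  from computes_comp1[OF this assms] show ?thesis by simp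
qed

lemma computes_const: "computes n (\<lambda>xs. c)"
proof (induction c)
  case 0
  show ?case unfolding computes_def using total_recursive.zero by blast
next
  case (Suc c)
  then show ?case by (rule computes_Suc)
qed

lemma computes_prim_rec:
  assumes "computes n F" "computes (Suc (Suc n)) G"
  shows "computes (Suc n) (\<lambda>xs. rec_nat (F (tl xs)) (\<lambda>m r. G (m # r # tl xs)) (hd xs))"
proof -
  obtain f g where f: "total_recursive n f" "\<And>xs. length xs = n \<Longrightarrow> f xs = F xs"
    and g: "total_recursive (Suc (Suc n)) g" "\<And>xs. length xs = Suc (Suc n) \<Longrightarrow> g xs = G xs"
    using assms unfolding computes_def by blast
  have "rec_nat (f (tl xs)) (\<lambda>m r. g (m # r # tl xs)) k = rec_nat (F (tl xs)) (\<lambda>m r. G (m # r # tl xs)) k"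
    if "length xs = Suc n" for xs k
    using that by (induction k) (simp_all add: f g)
  then show ?thesis
    unfolding computes_def using total_recursive.prim_rec[OF f(1) g(1)] by blast
qed

lemma computes_minim:
  assumes "computes (Suc n) F" and ex: "\<And>xs. length xs = n \<Longrightarrow> \<exists>y. F (y # xs) = 0"
  shows "computes n (\<lambda>xs. LEAST y. F (y # xs) = 0)"
proof -
  obtain f where f: "total_recursive (Suc n) f" "\<And>xs. length xs = Suc n \<Longrightarrow> f xs = F xs"
    using assms unfolding computes_def by blast
  have "total_recursive n (\<lambda>xs. LEAST y. f (y # xs) = 0)"
    using f ex by (intro total_recursive.minim) auto
  then show ?thesis
    unfolding computes_def using f(2) by (intro exI conjI) auto
qed

lemma length_eq_2_conv: "length xs = 2 \<longleftrightarrow> (\<exists>x y. xs = [x, y])"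
  by (auto simp: numeral_2_eq_2 length_Suc_conv)

lemma computes_add:
  assumes "computes n F" "computes n G" shows "computes n (\<lambda>xs. F xs + G xs)"
proof -
  have rec: "rec_nat y (\<lambda>m r. Suc r) x = x + y" for x y :: nat
    by (induction x) auto
  \<comment> \<open>The recursion runs on the first argument; position \<open>1\<close> of
    \<open>m # r # tl xs\<close> holds the previous value.\<close>
  have "computes (Suc 1) (\<lambda>xs. rec_nat (tl xs ! 0) (\<lambda>m r. Suc ((m # r # tl xs) ! 1)) (hd xs))"
    by (intro computes_prim_rec computes_Suc computes_proj) auto
  then have "computes 2 (\<lambda>xs. xs ! 0 + xs ! 1)"
    by (auto simp: length_eq_2_conv numeral_2_eq_2[symmetric] rec elim!: computes_cong)
  from computes_comp2[OF this assms] show ?thesis by simp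
qed

lemma computes_mult:
  assumes "computes n F" "computes n G" shows "computes n (\<lambda>xs. F xs * G xs)"
proof -
  have rec: "rec_nat 0 (\<lambda>m r. r + y) x = x * y" for x y :: nat
    by (induction x) auto
  have "computes (Suc 1) (\<lambda>xs. rec_nat 0 (\<lambda>m r. (m # r # tl xs) ! 1 + (m # r # tl xs) ! 2) (hd xs))"
    by (intro computes_prim_rec computes_add computes_const computes_proj) auto
  then have "computes 2 (\<lambda>xs. xs ! 0 * xs ! 1)"
    by (auto simp: length_eq_2_conv numeral_2_eq_2[symmetric] rec elim!: computes_cong)
  from computes_comp2[OF this assms] show ?thesis by simp
qed

text \<open>The predecessor is a primitive recursion that returns its counter and ignores the
  previous value; truncated subtraction iterates it. The recursion runs over the subtrahend, hence
  the swapped arguments at the end.\<close>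

lemma computes_diff:
  assumes "computes n F" "computes n G" shows "computes n (\<lambda>xs. F xs - G xs)"
proof -
  have "computes (Suc 0) (\<lambda>xs. rec_nat 0 (\<lambda>m r. (m # r # tl xs) ! 0) (hd xs))"
    by (intro computes_prim_rec computes_const computes_proj) auto
  moreover have "rec_nat 0 (\<lambda>m r. m) x = x - 1" for x :: nat
    by (cases x) auto
  ultimately have pred: "computes 1 (\<lambda>xs. hd xs - 1)"
    by simp
  have rec: "rec_nat y (\<lambda>m r. r - Suc 0) x = y - x" for x y :: nat
    by (induction x) auto
  have "computes (Suc (Suc 1)) (\<lambda>xs. hd [xs ! 1] - 1)"
    by (rule computes_comp1[OF pred]) (simp add: computes_proj)
  then have "computes (Suc 1) (\<lambda>xs. rec_nat (tl xs ! 0) (\<lambda>m r. hd [(m # r # tl xs) ! 1] - 1) (hd xs))"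
    by (intro computes_prim_rec computes_proj) auto
  then have "computes 2 (\<lambda>xs. xs ! 1 - xs ! 0)"
    by (auto simp: length_eq_2_conv numeral_2_eq_2[symmetric] rec elim!: computes_cong)
  from computes_comp2[OF this assms(2,1)] show ?thesis by simp
qed

text \<open>Truncated subtraction turns the inequality \<open>k < (Suc y)\<^sup>2\<close> into the
  vanishing of a term, the form that minimisation requires.\<close>

lemma floor_sqrt_eq_Least: "floor_sqrt k = (LEAST y. Suc k - Suc y * Suc y = 0)"
proof (rule Least_equality[symmetric])
  show "Suc k - Suc (floor_sqrt k) * Suc (floor_sqrt k) = 0"
    using Suc_floor_sqrt_power2_gt[of k] by (simp add: power2_eq_square)
next
  fix y assume "Suc k - Suc y * Suc y = 0"
  then have "k < (Suc y)\<^sup>2" by (simp add: power2_eq_square)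
  then have "floor_sqrt k < Suc y"
    by (metis floor_sqrt_power2_le le_less_trans power_less_imp_less_base zero_le)
  then show "floor_sqrt k \<le> y" by simp
qed

lemma computes_floor_sqrt:
  assumes "computes n F" shows "computes n (\<lambda>xs. floor_sqrt (F xs))"
proof -
  have "computes (Suc 1) (\<lambda>xs. Suc (xs ! 1) - Suc (xs ! 0) * Suc (xs ! 0))"
    by (intro computes_diff computes_mult computes_Suc computes_proj) auto
  \<comment> \<open>The search is total: \<open>y = k\<close> succeeds, because
    \<open>Suc k \<le> Suc k * Suc k\<close>.\<close>
  then have "computes 1 (\<lambda>xs. LEAST y. Suc ((y # xs) ! 1) - Suc ((y # xs) ! 0) * Suc ((y # xs) ! 0) = 0)"
    by (rule computes_minim) (metis One_nat_def diff_is_0_eq le_add1 mult_Suc nth_Cons_0 nth_Cons_Suc)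
  then have "computes 1 (\<lambda>xs. floor_sqrt (xs ! 0))"
    by (simp add: floor_sqrt_eq_Least)
  from computes_comp1[OF this assms] show ?thesis by simp
qed

lemma computable_rat_seq_quotient:
  assumes p: "computes 1 (\<lambda>xs. p (xs ! 0))" and q: "computes 1 (\<lambda>xs. q (xs ! 0))"
    and "\<And>k. q k \<noteq> 0"
  shows "computable_rat_seq (\<lambda>k. of_nat (p k) / of_nat (q k))"
proof -
  obtain f where f: "total_recursive 1 f" "\<And>xs. length xs = 1 \<Longrightarrow> f xs = p (xs ! 0)"
    using p unfolding computes_def by blast
  obtain g where g: "total_recursive 1 g" "\<And>xs. length xs = 1 \<Longrightarrow> g xs = q (xs ! 0)"
    using q unfolding computes_def by blast
  show ?thesis
    unfolding computable_rat_seq_def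
    \<comment> \<open>The entries are nonnegative, so the exponent of the sign is the zero
      function.\<close>
    by (intro exI[of _ "\<lambda>xs. 0"] exI[of _ f] exI[of _ g])
       (use f g assms(3) in \<open>auto intro: total_recursive.zero\<close>)
qed

subsection \<open>The chronological radius\<close>

lemma inner_P_vec: "P_vec \<bullet> x = x $ 2 + x $ 4"
  by (simp add: P_vec_def inner_vec_def sum_4)

text \<open>For \<open>\<epsilon> = 0\<close> the block rows are \<open>(A_0, 0)\<close> and
  \<open>(A_2, A_1)\<close>; for \<open>\<epsilon> = 1\<close> they are \<open>(A_1, A_0)\<close>
  and \<open>(0, A_2)\<close>. On \<open>ker P\<close> the fourth coordinate is minus the second,
  which merges the entries \<open>1\<close> and \<open>1 / 2\<close> into \<open>1 / 2\<close> up to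
  sign.\<close>

lemma T_mat_0_ker_P:
  assumes "P_vec \<bullet> x = 0"
  shows "(T_mat a t k 0 *v x) $ 1 = a k * x $ 1"
    and "(T_mat a t k 0 *v x) $ 2 = x $ 2 / 2"
    and "(T_mat a t k 0 *v x) $ 3 = t k * x $ 2"
    and "(T_mat a t k 0 *v x) $ 4 = - x $ 2 / 2"
proof -
  have "x $ 4 = - x $ 2" using assms by (simp add: inner_P_vec)
  then show "(T_mat a t k 0 *v x) $ 1 = a k * x $ 1"
    "(T_mat a t k 0 *v x) $ 2 = x $ 2 / 2"
    "(T_mat a t k 0 *v x) $ 3 = t k * x $ 2"
    "(T_mat a t k 0 *v x) $ 4 = - x $ 2 / 2"
    by (simp_all add: T_mat_def matrix_vector_mult_def sum_4 block_of_def pos_of_def mask_def)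
qed

lemma T_mat_1_ker_P:
  assumes "P_vec \<bullet> x = 0"
  shows "(T_mat a t k 1 *v x) $ 1 = a k * x $ 3"
    and "(T_mat a t k 1 *v x) $ 2 = x $ 2 / 2"
    and "(T_mat a t k 1 *v x) $ 3 = - t k * x $ 2"
    and "(T_mat a t k 1 *v x) $ 4 = - x $ 2 / 2"
proof -
  have "x $ 4 = - x $ 2" using assms by (simp add: inner_P_vec)
  then show "(T_mat a t k 1 *v x) $ 1 = a k * x $ 3"
    "(T_mat a t k 1 *v x) $ 2 = x $ 2 / 2"
    "(T_mat a t k 1 *v x) $ 3 = - t k * x $ 2"
    "(T_mat a t k 1 *v x) $ 4 = - x $ 2 / 2"
    by (simp_all add: T_mat_def matrix_vector_mult_def sum_4 block_of_def pos_of_def mask_def)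
qed

lemma T_mat_ker_P:
  assumes "P_vec \<bullet> x = 0" "\<epsilon> \<in> {0, 1}"
  shows "P_vec \<bullet> (T_mat a t k \<epsilon> *v x) = 0"
  using assms by (auto simp: inner_P_vec[of "T_mat _ _ _ _ *v _"] T_mat_0_ker_P T_mat_1_ker_P)

text \<open>The matrix products before compression to the kernel: no basis enters, so estimates for
  them are independent of \<open>U\<close>.\<close>

fun T_apply :: "(nat \<Rightarrow> real) \<Rightarrow> (nat \<Rightarrow> real) \<Rightarrow> nat \<Rightarrow> int list \<Rightarrow> real ^ 4 \<Rightarrow> real ^ 4" where
  "T_apply a t b [] x = x"
| "T_apply a t b (\<epsilon> # \<epsilon>s) x = T_mat a t b \<epsilon> *v T_apply a t (Suc b) \<epsilon>s x"

lemma T_apply_ker_P: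
  assumes "P_vec \<bullet> x = 0" "set \<epsilon>s \<subseteq> {0, 1}"
  shows "P_vec \<bullet> T_apply a t b \<epsilon>s x = 0"
  using assms by (induction \<epsilon>s arbitrary: b) (simp_all add: T_mat_ker_P)

section \<open>The isometry between \<open>real ^ 3\<close> and \<open>ker P\<close> given by an
  orthonormal basis\<close>

context
  notes transpose_matrix_vector [simp del]
  fixes U :: "real ^ 3 ^ 4"
  assumes U: "onb_ker_P U"
begin

lemma transpose_U_U: "transpose U ** U = mat 1"
proof -
  have "(transpose U ** U) $ i $ j = column i U \<bullet> column j U" for i j
    by (simp add: matrix_matrix_mult_def transpose_def column_def inner_vec_def)
  then show ?thesis
    using U by (auto simp: vec_eq_iff mat_def onb_ker_P_def orthogonal_def norm_eq_1)
qed

lemma transpose_U_U_apply: "transpose U *v (U *v y) = y"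
  by (simp add: matrix_vector_mul_assoc transpose_U_U)

lemma U_ker_P: "P_vec \<bullet> (U *v y) = 0"
proof -
  have "U *v y \<in> span (columns U)"
    using matrix_vector_mult_in_columnspace by blast
  then show ?thesis using U by (auto simp: onb_ker_P_def)
qed

text \<open>The columns of \<open>U\<close> span \<open>ker P\<close>, so \<open>x = U *v y\<close>
  for some \<open>y\<close>, and \<open>transpose U\<close> recovers \<open>y\<close>.\<close>

lemma U_transpose_U_apply:
  assumes "P_vec \<bullet> x = 0"
  shows "U *v (transpose U *v x) = x"
proof -
  have "x \<in> span (columns U)" using U assms by (simp add: onb_ker_P_def)
  moreover have "span (columns U) \<subseteq> range ((*v) U)"
  proof (rule span_minimal)
    show "columns U \<subseteq> range ((*v) U)"
      by (auto simp: columns_def simp flip: matrix_vector_mult_basis)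
    show "subspace (range ((*v) U))"
      by (intro linear_subspace_image matrix_vector_mul_linear subspace_UNIV)
  qed
  ultimately obtain y where "x = U *v y" by blast
  then show ?thesis by (simp add: transpose_U_U_apply)
qed

lemma norm_transpose_U:
  assumes "P_vec \<bullet> x = 0"
  shows "norm (transpose U *v x) = norm x"
proof -
  \<comment> \<open>\<open>U\<close> and \<open>transpose U\<close> are adjoint to each
    other.\<close>
  have "(transpose U *v x) \<bullet> (transpose U *v x) = x \<bullet> (U *v (transpose U *v x))"
    by (metis dot_lmul_matrix inner_commute transpose_matrix_vector transpose_transpose)
  then show ?thesis
    by (simp add: U_transpose_U_apply[OF assms] norm_eq_sqrt_inner)
qed

text \<open>Consecutive factors meet in \<open>U ** transpose U\<close>, which is the identity on
  \<open>ker P\<close>; as each \<open>T_mat\<close> preserves \<open>ker P\<close>, these inner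
  factors cancel and the compressed product is the full one in other coordinates.\<close>

lemma C_prod_apply:
  assumes "P_vec \<bullet> x = 0" "set \<epsilon>s \<subseteq> {0, 1}"
  shows "C_prod U a t b \<epsilon>s *v (transpose U *v x) = transpose U *v T_apply a t b \<epsilon>s x"
  using assms
proof (induction \<epsilon>s arbitrary: b)
  case (Cons \<epsilon> \<epsilon>s)
  then have "C_prod U a t b (\<epsilon> # \<epsilon>s) *v (transpose U *v x) =
      transpose U *v (T_mat a t b \<epsilon> *v (U *v (transpose U *v T_apply a t (Suc b) \<epsilon>s x)))"
    by (simp add: C_mat_def flip: matrix_vector_mul_assoc)
  also have "\<dots> = transpose U *v T_apply a t b (\<epsilon> # \<epsilon>s) x"
    using Cons.prems by (simp add: U_transpose_U_apply T_apply_ker_P)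
  finally show ?case .
qed simp

end

text \<open>
  Under \<open>T\<^sub>0\<close> and \<open>T\<^sub>1\<close> the second coordinate feeds the third with a factor of at most \<open>1\<close>; the weight
  \<open>10 / 9\<close> on it makes every admissible step a contraction by \<open>9 / 10\<close>.
\<close>

definition adapted_norm :: "real ^ 4 \<Rightarrow> real" where
  "adapted_norm x = Max {\<bar>x $ 1\<bar>, \<bar>x $ 3\<bar>, 10 / 9 * \<bar>x $ 2\<bar>}"

lemma adapted_norm_le_iff:
  "adapted_norm x \<le> r \<longleftrightarrow> \<bar>x $ 1\<bar> \<le> r \<and> \<bar>x $ 3\<bar> \<le> r \<and> 10 / 9 * \<bar>x $ 2\<bar> \<le> r"
  unfolding adapted_norm_def by (subst Max_le_iff) auto

lemma adapted_norm_T_mat: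
  assumes "P_vec \<bullet> x = 0" "\<epsilon> \<in> {0, 1}" "a k \<in> {0..9/10}" "t k \<in> {0..1}"
  shows "adapted_norm (T_mat a t k \<epsilon> *v x) \<le> 9 / 10 * adapted_norm x"
proof -
  have a: "\<bar>a k * y\<bar> \<le> 9 / 10 * \<bar>y\<bar>" for y
    using assms(3) mult_right_mono[of "a k" "9 / 10" "\<bar>y\<bar>"] by (simp add: abs_mult)
  have t: "\<bar>t k * y\<bar> \<le> \<bar>y\<bar>" for y
    using assms(4) by (auto simp: abs_mult intro!: mult_left_le_one_le)
  define N where "N = adapted_norm x"
  have N: "\<bar>x $ 1\<bar> \<le> N" "\<bar>x $ 3\<bar> \<le> N" "10 / 9 * \<bar>x $ 2\<bar> \<le> N"
    using adapted_norm_le_iff[of x N] by (simp_all add: N_def)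
  \<comment> \<open>The weight on the second coordinate gives
    \<open>\<bar>x $ 2\<bar> \<le> 9 / 10 * N\<close>, which controls the new third coordinate; the
    new second coordinate is halved, and \<open>1 / 2 \<le> 9 / 10\<close>.\<close>
  have bounds: "\<bar>a k * x $ 1\<bar> \<le> 9 / 10 * N" "\<bar>a k * x $ 3\<bar> \<le> 9 / 10 * N"
      "\<bar>t k * x $ 2\<bar> \<le> 9 / 10 * N" "10 / 9 * \<bar>x $ 2 / 2\<bar> \<le> 9 / 10 * N"
    using a[of "x $ 1"] a[of "x $ 3"] t[of "x $ 2"] N by linarith+
  consider "\<epsilon> = 0" | "\<epsilon> = 1" using assms(2) by blast
  then show ?thesis
    unfolding N_def[symmetric] adapted_norm_le_iff
    using bounds
    by cases (simp_all only: T_mat_0_ker_P[OF assms(1)] T_mat_1_ker_P[OF assms(1)]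
      mult_minus_left abs_minus_cancel simp_thms)
qed

lemma adapted_norm_T_apply:
  assumes "P_vec \<bullet> x = 0" "set \<epsilon>s \<subseteq> {0, 1}" "1 \<le> b"
    and "\<And>k. 1 \<le> k \<Longrightarrow> a k \<in> {0..9/10}" "\<And>k. 1 \<le> k \<Longrightarrow> t k \<in> {0..1}"
  shows "adapted_norm (T_apply a t b \<epsilon>s x) \<le> (9 / 10) ^ length \<epsilon>s * adapted_norm x"
  using assms(1-3)
proof (induction \<epsilon>s arbitrary: b)
  case (Cons \<epsilon> \<epsilon>s)
  have "adapted_norm (T_apply a t b (\<epsilon> # \<epsilon>s) x) \<le> 9 / 10 * adapted_norm (T_apply a t (Suc b) \<epsilon>s x)"
    unfolding T_apply.simps using Cons.prems assms(4,5)
    by (intro adapted_norm_T_mat T_apply_ker_P) auto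
  also have "\<dots> \<le> 9 / 10 * ((9 / 10) ^ length \<epsilon>s * adapted_norm x)"
    using Cons by (intro mult_left_mono Cons.IH) auto
  finally show ?case by simp
qed simp

lemma adapted_norm_le: "adapted_norm x \<le> 2 * norm x"
  using component_le_norm_cart[of x 1] component_le_norm_cart[of x 2] component_le_norm_cart[of x 3]
  by (auto simp: adapted_norm_def)

text \<open>\<open>adapted_norm\<close> ignores the fourth coordinate and is a norm only on
  \<open>ker P\<close>, where that coordinate is minus the second. The factor \<open>4\<close>
  counts the terms of the l1 norm.\<close>

lemma norm_le_adapted_norm:
  assumes "P_vec \<bullet> x = 0"
  shows "norm x \<le> 4 * adapted_norm x"
proof -
  have "x $ 4 = - x $ 2" using assms by (simp add: inner_P_vec)
  moreover have "\<bar>x $ 1\<bar> \<le> adapted_norm x" "\<bar>x $ 2\<bar> \<le> adapted_norm x" "\<bar>x $ 3\<bar> \<le> adapted_norm x"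
    by (auto simp: adapted_norm_def)
  ultimately show ?thesis
    using norm_le_l1_cart[of x] by (simp add: sum_4)
qed

text \<open>The contraction by \<open>9 / 10\<close> holds in the adapted norm; passing to it and
  back to the Euclidean norm costs the factors \<open>2\<close> and \<open>4\<close>, hence
  \<open>8\<close>. The bound is uniform in \<open>b\<close>, as the supremum in \<open>chi\<close>
  demands.\<close>

lemma onorm_C_prod_le:
  assumes U: "onb_ker_P U" and "set \<epsilon>s \<subseteq> {0, 1}" "1 \<le> b"
    and "\<And>k. 1 \<le> k \<Longrightarrow> a k \<in> {0..9/10}" "\<And>k. 1 \<le> k \<Longrightarrow> t k \<in> {0..1}"
  shows "onorm ((*v) (C_prod U a t b \<epsilon>s)) \<le> 8 * (9 / 10) ^ length \<epsilon>s"
proof (rule onorm_le)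
  fix y :: "real ^ 3"
  define x where "x = U *v y"
  have x: "P_vec \<bullet> x = 0" "y = transpose U *v x"
    by (simp_all add: x_def U_ker_P[OF U] transpose_U_U_apply[OF U] del: transpose_matrix_vector)
  have T: "P_vec \<bullet> T_apply a t b \<epsilon>s x = 0"
    using assms x by (intro T_apply_ker_P) auto
  have "norm (C_prod U a t b \<epsilon>s *v y) = norm (T_apply a t b \<epsilon>s x)"
    using assms(2) x T by (simp add: C_prod_apply[OF U] norm_transpose_U[OF U] del: transpose_matrix_vector)
  also have "\<dots> \<le> 4 * adapted_norm (T_apply a t b \<epsilon>s x)"
    by (rule norm_le_adapted_norm[OF T])
  also have "\<dots> \<le> 4 * ((9 / 10) ^ length \<epsilon>s * (2 * norm x))"
  proof -
    have "adapted_norm (T_apply a t b \<epsilon>s x) \<le> (9 / 10) ^ length \<epsilon>s * adapted_norm x"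
      using assms x by (intro adapted_norm_T_apply) auto
    also have "\<dots> \<le> (9 / 10) ^ length \<epsilon>s * (2 * norm x)"
      by (intro mult_left_mono adapted_norm_le) auto
    finally show ?thesis by (intro mult_left_mono) auto
  qed
  also have "norm x = norm y"
    using x by (simp add: norm_transpose_U[OF U] del: transpose_matrix_vector)
  finally show "norm (C_prod U a t b \<epsilon>s *v y) \<le> 8 * (9 / 10) ^ length \<epsilon>s * norm y"
    by simp
qed

section \<open>The lower bound from runs, and the value of the radius\<close>

lemma T_apply_replicate_axis:
  "T_apply a t b (replicate m 0) (axis 1 1) = (\<Prod>i<m. a (b + i)) *\<^sub>R axis 1 1"
proof (induction m arbitrary: b)
  case (Suc m)
  have P: "P_vec \<bullet> axis 1 1 = 0" by (simp add: inner_P_vec axis_def)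
  \<comment> \<open>The first basis vector lies in \<open>ker P\<close> and is an eigenvector of
    every \<open>T_mat a t b 0\<close>, with eigenvalue \<open>a b\<close>.\<close>
  have "T_mat a t b 0 *v axis 1 1 = a b *\<^sub>R axis 1 1"
    unfolding vec_eq_iff forall_4 T_mat_0_ker_P[OF P] by (simp add: axis_def)
  then show ?case
    unfolding replicate_Suc T_apply.simps Suc.IH matrix_vector_mult_scaleR prod.lessThan_Suc_shift
    by simp
qed simp

lemma onorm_C_prod_replicate_ge:
  assumes U: "onb_ker_P U"
  shows "\<bar>\<Prod>i<m. a (b + i)\<bar> \<le> onorm ((*v) (C_prod U a t b (replicate m 0)))"
proof -
  have P: "P_vec \<bullet> axis 1 1 = 0" by (simp add: inner_P_vec axis_def)
  define y where "y = transpose U *v axis 1 1"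
  have y: "norm y = 1" unfolding y_def by (simp add: norm_transpose_U[OF U P] del: transpose_matrix_vector)
  have "C_prod U a t b (replicate m 0) *v y = (\<Prod>i<m. a (b + i)) *\<^sub>R y"
    unfolding y_def
    by (subst C_prod_apply[OF U P]) (auto simp: T_apply_replicate_axis matrix_vector_mult_scaleR simp del: transpose_matrix_vector)
  then have "\<bar>\<Prod>i<m. a (b + i)\<bar> = norm (C_prod U a t b (replicate m 0) *v y)"
    by (simp add: y)
  also have "\<dots> \<le> onorm ((*v) (C_prod U a t b (replicate m 0))) * norm y"
    by (intro onorm matrix_vector_mul_bounded_linear)
  finally show ?thesis by (simp add: y)
qed

text \<open>The upper bound holds for every starting index, whereas the lower one needs a single run
  of length \<open>m\<close>, wherever it begins: the supremum over \<open>b\<close> finds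
  it.\<close>

lemma chi_bounds:
  assumes U: "onb_ker_P U"
    and a: "\<And>k. 1 \<le> k \<Longrightarrow> a k \<in> {0..9/10}" and t: "\<And>k. 1 \<le> k \<Longrightarrow> t k \<in> {0..1}"
    and b: "1 \<le> b" and run: "\<And>i. i < m \<Longrightarrow> a (b + i) = 9 / 10"
  shows "(9 / 10) ^ m \<le> chi U a t m" and "chi U a t m \<le> 8 * (9 / 10) ^ m"
proof -
  let ?W = "{\<epsilon>s :: int list. length \<epsilon>s = m \<and> set \<epsilon>s \<subseteq> {0, 1}}"
  let ?f = "\<lambda>b \<epsilon>s. onorm ((*v) (C_prod U a t b \<epsilon>s))"
  have fin: "finite ?W"
    using finite_lists_length_eq[of "{0, 1 :: int}" m] by (simp add: conj_commute)
  have mem: "replicate m 0 \<in> ?W" by auto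
  then have ne: "?f b ` ?W \<noteq> {}" for b by blast
  have le: "Max (?f b ` ?W) \<le> 8 * (9 / 10) ^ m" if "1 \<le> b" for b
  proof (rule Max.boundedI)
    fix y assume "y \<in> ?f b ` ?W"
    then obtain \<epsilon>s where "y = ?f b \<epsilon>s" "length \<epsilon>s = m" "set \<epsilon>s \<subseteq> {0, 1}" by blast
    then show "y \<le> 8 * (9 / 10) ^ m"
      using onorm_C_prod_le[where a = a and t = t, OF U _ that a t] by blast
  qed (use fin ne in auto)
  then show "chi U a t m \<le> 8 * (9 / 10) ^ m"
    unfolding chi_def by (intro cSUP_least) auto
  have "(\<Prod>i<m. a (b + i)) = (\<Prod>i<m. 9 / 10)"
    using run by (intro prod.cong) auto
  then have "(9 / 10) ^ m = \<bar>\<Prod>i<m. a (b + i)\<bar>"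
    by simp
  also have "\<dots> \<le> ?f b (replicate m 0)"
    by (rule onorm_C_prod_replicate_ge[OF U])
  also have "\<dots> \<le> Max (?f b ` ?W)"
    using fin mem by (intro Max_ge) auto
  \<comment> \<open>The uniform upper bound \<open>le\<close> makes the family bounded above,
    without which the supremum could not be compared with its members.\<close>
  also have "\<dots> \<le> chi U a t m"
    unfolding chi_def using b le by (intro cSUP_upper) (auto intro!: bdd_aboveI2)
  finally show "(9 / 10) ^ m \<le> chi U a t m" .
qed

lemma has_chronological_radius_of_runs:
  assumes a: "\<And>k. 1 \<le> k \<Longrightarrow> a k \<in> {0..9/10}"
    and runs: "\<And>m. \<exists>b\<ge>1. \<forall>i<m. a (b + i) = 9 / 10"
  shows "has_chronological_radius a (9 / 10)"
  unfolding has_chronological_radius_def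
proof (intro allI impI)
  fix t :: "nat \<Rightarrow> real" and U
  assume t: "\<forall>k\<ge>1. t k \<in> {0..1::real}" and U: "onb_ker_P U"
  have bounds: "(9 / 10) ^ m \<le> chi U a t m \<and> chi U a t m \<le> 8 * (9 / 10) ^ m" for m
  proof -
    obtain b where "1 \<le> b" "\<forall>i<m. a (b + i) = 9 / 10" using runs by blast
    then show ?thesis using chi_bounds[where a = a and t = t, OF U a, of b m] t by auto
  qed
  \<comment> \<open>The case \<open>m = 0\<close> is excluded because \<open>root 0\<close> is zero
    by convention.\<close>
  have root: "root m ((9 / 10) ^ m) = 9 / 10" if "0 < m" for m
    using that by (simp add: real_root_power_cancel)
  show "(\<lambda>m. root m (chi U a t m)) \<longlonglongrightarrow> 9 / 10"
  proof (rule tendsto_sandwich)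
    show "\<forall>\<^sub>F m in sequentially. 9 / 10 \<le> root m (chi U a t m)"
      using eventually_gt_at_top[of 0] by eventually_elim (metis bounds root real_root_le_mono)
    show "\<forall>\<^sub>F m in sequentially. root m (chi U a t m) \<le> root m 8 * (9 / 10)"
      using eventually_gt_at_top[of 0]
      by eventually_elim (metis bounds root real_root_le_mono real_root_mult)
    \<comment> \<open>The \<open>m\<close>-th root removes the constant lost in the comparison of
      norms.\<close>
    show "(\<lambda>m. root m 8 * (9 / 10)) \<longlonglongrightarrow> 9 / 10"
      using tendsto_mult[OF LIMSEQ_root_const[of 8] tendsto_const[of "9 / 10"]] by simp
  qed simp
qed

subsection \<open>Metric entropy\<close>

lemma hat_nonneg: "0 \<le> hat y" and hat_le_1: "hat y \<le> 1"
  by (auto simp: hat_def)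

text \<open>The bump of level \<open>k\<close> lives where \<open>2 < 2 ^ k * x < 4\<close>, and
  these open dyadic intervals are pairwise disjoint.\<close>

lemma hat_dilation_disjoint:
  assumes "hat (2 ^ j * x - 2) \<noteq> 0" "hat (2 ^ k * x - 2) \<noteq> 0"
  shows "j = k"
proof -
  have supp: "2 < 2 ^ i * x \<and> 2 ^ i * x < 4" if "hat (2 ^ i * x - 2) \<noteq> 0" for i :: nat
    using that by (auto simp: hat_def max_def split: if_splits)
  have no: False if "i < l" "2 < 2 ^ i * x" "2 ^ l * x < 4" for i l :: nat
  proof -
    have "0 < x" using that(2) by (smt (verit) mult_nonneg_nonpos zero_le_power)
    moreover have "(2::real) ^ Suc i \<le> 2 ^ l" using that(1) by (intro power_increasing) auto
    ultimately have "2 ^ Suc i * x \<le> 2 ^ l * x" by (intro mult_right_mono) auto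
    with that(2,3) show False by simp
  qed
  show ?thesis
    using supp[OF assms(1)] supp[OF assms(2)] no[of j k] no[of k j] by (meson nat_neq_iff)
qed

text \<open>The series collapses to one term. Bump \<open>k\<close> itself may vanish at
  \<open>x\<close>, so the lemma also yields \<open>phi a t x = 0\<close> away from all
  supports.\<close>

lemma phi_single:
  assumes "1 \<le> k" and "\<And>j. \<lbrakk>1 \<le> j; j \<noteq> k\<rbrakk> \<Longrightarrow> hat (2 ^ j * x - 2) = 0"
  shows "phi a t x = weight a k * t k * hat (2 ^ k * x - 2)"
proof -
  obtain k' where k: "k = Suc k'" using assms(1) by (cases k) auto
  have "phi a t x = (\<Sum>i\<in>{k'}. weight a (Suc i) * t (Suc i) * hat (2 ^ Suc i * x - 2))"
    unfolding phi_def
  proof (intro suminf_finite)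
    fix i assume "i \<notin> {k'}"
    then have "hat (2 ^ Suc i * x - 2) = 0" using k by (intro assms(2)) auto
    then show "weight a (Suc i) * t (Suc i) * hat (2 ^ Suc i * x - 2) = 0" by simp
  qed simp
  then show ?thesis by (simp add: k)
qed

text \<open>The hat attains its maximum \<open>1\<close> at argument \<open>1\<close>, and
  \<open>2 ^ k * x - 2 = 1\<close> at \<open>x = 3 / 2 ^ k\<close>.\<close>

lemma phi_peak:
  assumes "1 \<le> k"
  shows "phi a t (3 / 2 ^ k) = weight a k * t k"
proof -
  have h: "hat (2 ^ k * (3 / 2 ^ k) - 2) = 1" by (simp add: hat_def)
  have "phi a t (3 / 2 ^ k) = weight a k * t k * hat (2 ^ k * (3 / 2 ^ k) - 2)"
    using hat_dilation_disjoint[of _ "3 / 2 ^ k" k] h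
    by (intro phi_single assms) (metis zero_neq_one)
  then show ?thesis by (simp only: h)
qed

section \<open>Coverings of the box of coefficients\<close>

definition finite_cover :: "real \<Rightarrow> (real \<Rightarrow> real) set \<Rightarrow> (real \<Rightarrow> real) set \<Rightarrow> bool" where
  "finite_cover \<epsilon> \<F> G \<longleftrightarrow> finite G \<and> (\<forall>g\<in>G. bounded (range g)) \<and>
    (\<forall>f\<in>\<F>. \<exists>g\<in>G. \<forall>x. \<bar>f x - g x\<bar> \<le> \<epsilon>)"

lemma covering_number_le_card:
  assumes "finite_cover \<epsilon> \<F> G"
  shows "covering_number \<epsilon> \<F> \<le> card G"
  unfolding covering_number_def using assms by (intro Least_le) (auto simp: finite_cover_def)

text \<open>\<open>covering_number\<close> is a \<open>LEAST\<close>, which is meaningful only once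
  some finite cover is known; \<open>G\<^sub>0\<close> provides it.\<close>

lemma covering_number_attained:
  assumes "finite_cover \<epsilon> \<F> G\<^sub>0"
  obtains G where "finite_cover \<epsilon> \<F> G" "card G = covering_number \<epsilon> \<F>"
proof -
  let ?P = "\<lambda>n. \<exists>G. finite G \<and> card G = n \<and> (\<forall>g\<in>G. bounded (range g)) \<and>
      (\<forall>f\<in>\<F>. \<exists>g\<in>G. \<forall>x. \<bar>f x - g x\<bar> \<le> \<epsilon>)"
  have "?P (card G\<^sub>0)" using assms by (auto simp: finite_cover_def)
  then have "?P (covering_number \<epsilon> \<F>)" unfolding covering_number_def by (rule LeastI)
  then show thesis using that by (auto simp: finite_cover_def)
qed

text \<open>Round each of the first \<open>n\<close> coefficients down to a multiple of
  \<open>\<epsilon>\<close> and drop the others, which are at most \<open>\<epsilon>\<close>. At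
  most one bump is nonzero at any point, so the errors of different levels never add up.\<close>

lemma function_class_finite_cover:
  assumes \<epsilon>: "0 < \<epsilon>" and w: "\<And>k. 0 \<le> weight a k" and small: "\<And>k. n < k \<Longrightarrow> weight a k \<le> \<epsilon>"
  obtains G where "finite_cover \<epsilon> (function_class a) G"
    "card G \<le> (\<Prod>k\<in>{1..n}. nat \<lfloor>weight a k / \<epsilon>\<rfloor> + 1)"
proof
  let ?g = "\<lambda>(j :: nat \<Rightarrow> nat) x. \<Sum>k\<in>{1..n}. \<epsilon> * real (j k) * hat (2 ^ k * x - 2)"
  let ?J = "PiE {1..n} (\<lambda>k. {..nat \<lfloor>weight a k / \<epsilon>\<rfloor>})"
  have fin: "finite ?J" by (intro finite_PiE) auto
  have "card (?g ` ?J) \<le> card ?J" by (rule card_image_le[OF fin])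
  then show "card (?g ` ?J) \<le> (\<Prod>k\<in>{1..n}. nat \<lfloor>weight a k / \<epsilon>\<rfloor> + 1)"
    by (simp add: card_PiE)
  show "finite_cover \<epsilon> (function_class a) (?g ` ?J)"
    unfolding finite_cover_def
  proof (intro conjI ballI)
    show "finite (?g ` ?J)" using fin by simp
  next
    fix g assume "g \<in> ?g ` ?J"
    then obtain j where g: "g = ?g j" by blast
    have "norm (g x) \<le> (\<Sum>k\<in>{1..n}. \<epsilon> * real (j k))" for x
      unfolding g using \<epsilon>
      by (intro sum_norm_le) (simp add: abs_mult hat_nonneg hat_le_1 mult_left_le)
    then show "bounded (range g)" by (auto simp: bounded_iff)
  next
    fix f assume "f \<in> function_class a"
    then obtain t where f: "f = phi a t" and t: "\<And>k. 1 \<le> k \<Longrightarrow> 0 \<le> t k \<and> t k \<le> 1"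
      unfolding function_class_def by auto
    define j where "j = restrict (\<lambda>k. nat \<lfloor>weight a k * t k / \<epsilon>\<rfloor>) {1..n}"
    have "j \<in> ?J"
      unfolding j_def using t w \<epsilon>
      by (intro restrict_PiE_iff[THEN iffD2])
         (auto intro!: nat_mono floor_mono divide_right_mono mult_left_le)
    moreover have "\<bar>f x - ?g j x\<bar> \<le> \<epsilon>" for x
    proof (cases "\<exists>k\<ge>1. hat (2 ^ k * x - 2) \<noteq> 0")
      case False
      then have "f x = 0" unfolding f by (subst phi_single[of 1]) auto
      moreover have "?g j x = 0" using False by (intro sum.neutral) auto
      ultimately show ?thesis using \<epsilon> by simp
    next
      case True
      then obtain k where k: "1 \<le> k" "hat (2 ^ k * x - 2) \<noteq> 0" by blast
      have other: "hat (2 ^ i * x - 2) = 0" if "i \<noteq> k" for i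
        using hat_dilation_disjoint[OF _ k(2)] that by blast
      have fx: "f x = weight a k * t k * hat (2 ^ k * x - 2)"
        unfolding f using other by (intro phi_single k(1)) auto
      have wt: "0 \<le> weight a k * t k" using w t k(1) by simp
      \<comment> \<open>The coefficient of the only active bump in the chosen centre; it is zero for
        the dropped levels.\<close>
      define c where "c = (if k \<le> n then \<epsilon> * real (j k) else 0)"
      have gx: "?g j x = c * hat (2 ^ k * x - 2)"
      proof (cases "k \<le> n")
        case True
        have "?g j x = (\<Sum>i\<in>{k}. \<epsilon> * real (j i) * hat (2 ^ i * x - 2))"
          using True k(1) other by (intro sum.mono_neutral_right) auto
        then show ?thesis using True by (simp add: c_def)
      next
        case False
        then show ?thesis using other by (auto simp: c_def intro!: sum.neutral)
      qed
      have "\<bar>weight a k * t k - c\<bar> \<le> \<epsilon>"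
      proof (cases "k \<le> n")
        case True
        define y where "y = weight a k * t k / \<epsilon>"
        have y: "0 \<le> y" unfolding y_def using wt \<epsilon> by simp
        have "real (j k) = of_int \<lfloor>y\<rfloor>"
          using True k(1) y by (simp add: j_def y_def)
        then have "\<bar>y - real (j k)\<bar> \<le> 1" by linarith
        then have "\<epsilon> * \<bar>y - real (j k)\<bar> \<le> \<epsilon>" using \<epsilon> by (simp add: mult_left_le)
        moreover have "weight a k * t k - c = \<epsilon> * (y - real (j k))"
          using True \<epsilon> by (simp add: c_def y_def algebra_simps)
        ultimately show ?thesis using \<epsilon> by (simp add: abs_mult)
      next
        case False
        have "weight a k * t k \<le> weight a k" using w t k(1) by (intro mult_left_le) auto
        also have "\<dots> \<le> \<epsilon>" using False by (intro small) auto
        finally show ?thesis using False wt by (simp add: c_def)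
      qed
      then have "\<bar>weight a k * t k - c\<bar> * hat (2 ^ k * x - 2) \<le> \<epsilon> * 1"
        using \<epsilon> by (intro mult_mono hat_le_1 hat_nonneg) auto
      then show ?thesis
        unfolding fx gx left_diff_distrib[symmetric] by (simp add: abs_mult hat_nonneg)
    qed
    ultimately show "\<exists>g\<in>?g ` ?J. \<forall>x. \<bar>f x - g x\<bar> \<le> \<epsilon>"
      by (intro bexI[of _ "?g j"]) auto
  qed
qed

text \<open>The values \<open>4 \<epsilon> j\<close> at the peaks are separated by more than the diameter \<open>2 \<epsilon>\<close> of a ball.\<close>

lemma function_class_cover_card_ge:
  assumes \<epsilon>: "0 < \<epsilon>" and w: "\<And>k. 0 < weight a k" and G: "finite_cover \<epsilon> (function_class a) G"
  shows "(\<Prod>k\<in>{1..n}. nat \<lfloor>weight a k / (4 * \<epsilon>)\<rfloor> + 1) \<le> card G"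
proof -
  let ?J = "PiE {1..n} (\<lambda>k. {..nat \<lfloor>weight a k / (4 * \<epsilon>)\<rfloor>})"
  \<comment> \<open>Scaled so that the peak of level \<open>k\<close> has height
    \<open>4 * \<epsilon> * real (j k)\<close>; the range of \<open>j k\<close> keeps the parameter
    in \<open>[0, 1]\<close>.\<close>
  define t where "t j k = (if k \<in> {1..n} then 4 * \<epsilon> * real (j k) / weight a k else 0)"
    for j :: "nat \<Rightarrow> nat" and k
  have "phi a (t j) \<in> function_class a" if j: "j \<in> ?J" for j
  proof -
    have "t j k \<in> {0..1}" for k
    proof (cases "k \<in> {1..n}")
      case True
      then have "j k \<le> nat \<lfloor>weight a k / (4 * \<epsilon>)\<rfloor>" using j by (auto simp: PiE_iff)
      then have "real (j k) \<le> weight a k / (4 * \<epsilon>)"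
        using w[of k] \<epsilon> by (simp add: le_nat_floor le_nat_iff le_floor_iff)
      then show ?thesis using True w[of k] \<epsilon> by (simp add: t_def field_simps)
    qed (auto simp: t_def)
    then show ?thesis unfolding function_class_def by blast
  qed
  then have "\<forall>j\<in>?J. \<exists>g\<in>G. \<forall>x. \<bar>phi a (t j) x - g x\<bar> \<le> \<epsilon>"
    using G unfolding finite_cover_def by blast
  then obtain F where F: "\<And>j. j \<in> ?J \<Longrightarrow> F j \<in> G"
      "\<And>j x. j \<in> ?J \<Longrightarrow> \<bar>phi a (t j) x - F j x\<bar> \<le> \<epsilon>"
    by metis
  have "inj_on F ?J"
  proof (rule inj_onI)
    fix i j assume ij: "i \<in> ?J" "j \<in> ?J" "F i = F j"
    show "i = j"
    proof (rule PiE_ext[OF ij(1,2)])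
      fix k assume k: "k \<in> {1..n}"
      have peak: "phi a (t l) (3 / 2 ^ k) = 4 * \<epsilon> * real (l k)" for l
        using k w[of k] by (simp add: phi_peak t_def)
      have "\<bar>4 * \<epsilon> * real (i k) - 4 * \<epsilon> * real (j k)\<bar> \<le> 2 * \<epsilon>"
        using F(2)[OF ij(1), of "3 / 2 ^ k"] F(2)[OF ij(2), of "3 / 2 ^ k"]
        unfolding peak ij(3) by linarith
      then have "(4 * \<epsilon>) * \<bar>real (i k) - real (j k)\<bar> \<le> 2 * \<epsilon>"
        using \<epsilon> by (simp add: abs_mult flip: right_diff_distrib)
      then have "\<bar>real (i k) - real (j k)\<bar> \<le> 1 / 2"
        using \<epsilon> by (simp add: field_simps)
      then show "i k = j k" by linarith
    qed
  qed
  then have "card ?J \<le> card G"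
    using F(1) G by (intro card_inj_on_le[of F]) (auto simp: finite_cover_def)
  then show ?thesis by (simp add: card_PiE)
qed

lemma log_prod_pos:
  fixes f :: "'a \<Rightarrow> real"
  assumes "finite A" "\<And>i. i \<in> A \<Longrightarrow> 0 < f i"
  shows "log b (\<Prod>i\<in>A. f i) = (\<Sum>i\<in>A. log b (f i))"
proof -
  have "ln (\<Prod>i\<in>A. f i) = (\<Sum>i\<in>A. ln (f i))"
    using assms(1) less_imp_neq[OF assms(2)] by (intro ln_prod) auto
  then show ?thesis by (simp add: log_def sum_divide_distrib)
qed

text \<open>Each level contributes to the covering number a factor between
  \<open>weight a k / (4 * \<epsilon>)\<close> and \<open>2 * weight a k / \<epsilon>\<close>, so
  its logarithm misses the summand by at most two bits below and one above.\<close>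

lemma entropy_function_class_bounds:
  assumes \<epsilon>: "0 < \<epsilon>" and w: "\<And>k. 0 < weight a k"
    and small: "\<And>k. n < k \<Longrightarrow> weight a k \<le> \<epsilon>"
    and large: "\<And>k. k \<in> {1..n} \<Longrightarrow> \<epsilon> \<le> weight a k"
  shows "\<bar>entropy \<epsilon> (function_class a) - (\<Sum>k\<in>{1..n}. log 2 (1 / \<epsilon>) + log 2 (weight a k))\<bar> \<le> 2 * real n"
proof -
  let ?N = "covering_number \<epsilon> (function_class a)"
  obtain G where G: "finite_cover \<epsilon> (function_class a) G"
    "card G \<le> (\<Prod>k\<in>{1..n}. nat \<lfloor>weight a k / \<epsilon>\<rfloor> + 1)"
    using function_class_finite_cover[OF \<epsilon> less_imp_le[OF w] small] by blast
  have upN: "?N \<le> (\<Prod>k\<in>{1..n}. nat \<lfloor>weight a k / \<epsilon>\<rfloor> + 1)"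
    using covering_number_le_card[OF G(1)] G(2) by linarith
  have loN: "(\<Prod>k\<in>{1..n}. nat \<lfloor>weight a k / (4 * \<epsilon>)\<rfloor> + 1) \<le> ?N"
    using covering_number_attained[OF G(1)] function_class_cover_card_ge[OF \<epsilon> w] by metis
  \<comment> \<open>Needed for the monotonicity of the logarithm; the lower bound is a product of
    positive integers.\<close>
  have pos: "0 < ?N"
    using loN by (rule less_le_trans[rotated]) (simp add: prod_pos)
  have log_quot: "log 2 (weight a k / \<epsilon>) = log 2 (1 / \<epsilon>) + log 2 (weight a k)" for k
    using \<epsilon> w[of k] by (simp add: log_divide)
  have "real ?N \<le> (\<Prod>k\<in>{1..n}. 2 * (weight a k / \<epsilon>))"
  proof -
    have "real ?N \<le> real (\<Prod>k\<in>{1..n}. nat \<lfloor>weight a k / \<epsilon>\<rfloor> + 1)"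
      using upN by (simp only: of_nat_le_iff)
    also have "\<dots> = (\<Prod>k\<in>{1..n}. real (nat \<lfloor>weight a k / \<epsilon>\<rfloor> + 1))"
      by (rule of_nat_prod)
    also have "\<dots> \<le> (\<Prod>k\<in>{1..n}. 2 * (weight a k / \<epsilon>))"
    proof (intro prod_mono conjI)
      fix k assume k: "k \<in> {1..n}"
      \<comment> \<open>Only for \<open>y \<ge> 1\<close> is the floor of \<open>y\<close> plus one
        at most \<open>2 * y\<close>, which is why levels below \<open>\<epsilon>\<close> are left
        out.\<close>
      have "1 \<le> weight a k / \<epsilon>" using large[OF k] \<epsilon> by simp
      then show "real (nat \<lfloor>weight a k / \<epsilon>\<rfloor> + 1) \<le> 2 * (weight a k / \<epsilon>)"
        by linarith
    qed simp
    finally show ?thesis .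
  qed
  then have "entropy \<epsilon> (function_class a) \<le> log 2 (\<Prod>k\<in>{1..n}. 2 * (weight a k / \<epsilon>))"
    unfolding entropy_def using pos by simp
  also have "\<dots> = (\<Sum>k\<in>{1..n}. log 2 (2 * (weight a k / \<epsilon>)))"
    using w \<epsilon> by (intro log_prod_pos) simp_all
  also have "\<dots> = (\<Sum>k\<in>{1..n}. 1 + (log 2 (1 / \<epsilon>) + log 2 (weight a k)))"
    by (intro sum.cong refl, subst log_mult_pos)
       (use w \<epsilon> log_quot in auto)
  also have "\<dots> = real n + (\<Sum>k\<in>{1..n}. log 2 (1 / \<epsilon>) + log 2 (weight a k))"
    by (subst sum.distrib) simp
  finally have up: "entropy \<epsilon> (function_class a) \<le>
      real n + (\<Sum>k\<in>{1..n}. log 2 (1 / \<epsilon>) + log 2 (weight a k))" .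
  have "(\<Prod>k\<in>{1..n}. weight a k / \<epsilon> / 4) \<le> real ?N"
  proof -
    have "(\<Prod>k\<in>{1..n}. weight a k / \<epsilon> / 4) \<le> (\<Prod>k\<in>{1..n}. real (nat \<lfloor>weight a k / (4 * \<epsilon>)\<rfloor> + 1))"
    proof (intro prod_mono conjI)
      fix k
      show "0 \<le> weight a k / \<epsilon> / 4" using w[of k] \<epsilon> by simp
      have "weight a k / \<epsilon> / 4 = weight a k / (4 * \<epsilon>)" by simp
      also have "\<dots> \<le> real (nat \<lfloor>weight a k / (4 * \<epsilon>)\<rfloor> + 1)" by linarith
      finally show "weight a k / \<epsilon> / 4 \<le> real (nat \<lfloor>weight a k / (4 * \<epsilon>)\<rfloor> + 1)" .
    qed
    also have "\<dots> = real (\<Prod>k\<in>{1..n}. nat \<lfloor>weight a k / (4 * \<epsilon>)\<rfloor> + 1)"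
      by (rule of_nat_prod[symmetric])
    also have "\<dots> \<le> real ?N" using loN by (simp only: of_nat_le_iff)
    finally show ?thesis .
  qed
  then have "log 2 (\<Prod>k\<in>{1..n}. weight a k / \<epsilon> / 4) \<le> entropy \<epsilon> (function_class a)"
    unfolding entropy_def using pos w \<epsilon> by (subst log_le_cancel_iff) (auto intro!: prod_pos)
  moreover have "log 2 (\<Prod>k\<in>{1..n}. weight a k / \<epsilon> / 4) = (\<Sum>k\<in>{1..n}. log 2 (weight a k / \<epsilon> / 4))"
    using w \<epsilon> by (intro log_prod_pos) simp_all
  moreover have "log 2 (4::real) = 2"
    using log_pow_cancel[of "2::real" 2] by simp
  then have "(\<Sum>k\<in>{1..n}. log 2 (weight a k / \<epsilon> / 4)) =
      (\<Sum>k\<in>{1..n}. (log 2 (1 / \<epsilon>) + log 2 (weight a k)) - 2)"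
    by (intro sum.cong refl, subst log_divide_pos)
       (use w \<epsilon> log_quot in auto)
  moreover have "\<dots> = (\<Sum>k\<in>{1..n}. log 2 (1 / \<epsilon>) + log 2 (weight a k)) - 2 * real n"
    by (subst sum_subtractf) simp
  ultimately show ?thesis using up by linarith
qed

section \<open>Sums of asymptotically linear sequences and the entropy limit\<close>

lemma sum_sublinear:
  fixes f :: "nat \<Rightarrow> real"
  assumes "(\<lambda>k. f k / real k) \<longlonglongrightarrow> 0"
  shows "(\<lambda>n. (\<Sum>k\<in>{1..n}. f k) / (real n)\<^sup>2) \<longlonglongrightarrow> 0"
proof (rule LIMSEQ_I)
  fix r :: real assume r: "0 < r"
  then obtain K where K: "\<And>k. K \<le> k \<Longrightarrow> \<bar>f k / real k\<bar> < r / 2"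
    using LIMSEQ_D[OF assms, of "r / 2"] by auto
  \<comment> \<open>\<open>M\<close> absorbs the finitely many indices before the ratio falls below
    \<open>r / 2\<close>.\<close>
  define M where "M = (\<Sum>k<K. \<bar>f k\<bar>)"
  have M: "0 \<le> M" unfolding M_def by (intro sum_nonneg) auto
  have f: "\<bar>f k\<bar> \<le> M + r / 2 * real k" if "1 \<le> k" for k
  proof (cases "k < K")
    case True
    then have "\<bar>f k\<bar> \<le> M" unfolding M_def by (intro member_le_sum) auto
    then show ?thesis using r by (simp add: add_increasing2)
  next
    case False
    then have "\<bar>f k\<bar> < r / 2 * real k" using K[of k] that by (simp add: abs_divide divide_simps)
    then show ?thesis using M by linarith
  qed
  \<comment> \<open>Beyond \<open>B\<close> the contribution \<open>real n * M\<close> is less than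
    the remaining half of \<open>r * (real n)\<^sup>2\<close>.\<close>
  obtain B where B: "2 * M / r < real B" using reals_Archimedean2 by blast
  have "norm ((\<Sum>k\<in>{1..n}. f k) / (real n)\<^sup>2 - 0) < r" if n: "Suc B \<le> n" for n
  proof -
    have "\<bar>\<Sum>k\<in>{1..n}. f k\<bar> \<le> (\<Sum>k\<in>{1..n}. M + r / 2 * real n)"
    proof (rule order_trans[OF sum_abs], rule sum_mono)
      fix k assume "k \<in> {1..n}"
      then show "\<bar>f k\<bar> \<le> M + r / 2 * real n"
        using f[of k] r by (auto elim!: order_trans)
    qed
    also have "\<dots> = real n * (M + r / 2 * real n)" by simp
    also have "\<dots> < real n * (r * real n)"
    proof (rule mult_strict_left_mono)
      have "2 * M < r * real B" using B r by (simp add: field_simps)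
      also have "\<dots> \<le> r * real n" using n r by simp
      finally show "M + r / 2 * real n < r * real n" by simp
    qed (use n in auto)
    finally show ?thesis using n by (simp add: divide_simps power2_eq_square mult_ac)
  qed
  then show "\<exists>no. \<forall>n\<ge>no. norm ((\<Sum>k\<in>{1..n}. f k) / (real n)\<^sup>2 - 0) < r" by blast
qed

text \<open>Subtracting \<open>c * real k\<close> leaves a sublinear sequence; the linear part sums
  to \<open>c * n * (n + 1) / 2\<close>.\<close>

lemma sum_asymptotically_linear:
  fixes L :: "nat \<Rightarrow> real"
  assumes "(\<lambda>k. L k / real k) \<longlonglongrightarrow> c"
  shows "(\<lambda>n. (\<Sum>k\<in>{1..n}. L k) / (real n)\<^sup>2) \<longlonglongrightarrow> c / 2"
proof -
  have "(\<lambda>k. L k / real k - c) \<longlonglongrightarrow> 0"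
    using assms by (simp add: LIM_zero_iff)
  then have "(\<lambda>k. (L k - c * real k) / real k) \<longlonglongrightarrow> 0"
    by (rule Lim_transform_eventually)
       (use eventually_gt_at_top[of 0] in eventually_elim, simp add: field_simps)
  from sum_sublinear[OF this]
  have "(\<lambda>n. (\<Sum>k\<in>{1..n}. L k - c * real k) / (real n)\<^sup>2 + c * ((1 + 1 / real n) / 2)) \<longlonglongrightarrow> 0 + c * ((1 + 0) / 2)"
    by (intro tendsto_intros lim_1_over_n) auto
  moreover have "\<forall>\<^sub>F n in sequentially.
      (\<Sum>k\<in>{1..n}. L k - c * real k) / (real n)\<^sup>2 + c * ((1 + 1 / real n) / 2) =
      (\<Sum>k\<in>{1..n}. L k) / (real n)\<^sup>2"
    using eventually_gt_at_top[of 0]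
  proof eventually_elim
    case (elim n)
    have "(\<Sum>k\<in>{1..n}. real k) = real n * (real n + 1) / 2"
      by (induction n) (auto simp: field_simps)
    then have "(\<Sum>k\<in>{1..n}. L k - c * real k) = (\<Sum>k\<in>{1..n}. L k) - c * (real n * (real n + 1) / 2)"
      by (simp add: sum_subtractf flip: sum_distrib_left)
    moreover have "c * (real n * (real n + 1) / 2) / (real n)\<^sup>2 = c * ((1 + 1 / real n) / 2)"
      using elim by (simp add: divide_simps power2_eq_square)
    ultimately show ?case by (simp add: diff_divide_distrib)
  qed
  ultimately show ?thesis
    by (auto intro: Lim_transform_eventually)
qed

text \<open>Let \<open>n\<close> be the number of levels of weight at least
  \<open>\<epsilon>\<close> and \<open>L k = - log 2 (weight a k)\<close>. Then \<open>X\<close> is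
  asymptotic to \<open>c * n\<close>, the sum of \<open>X - L k\<close> over these levels to
  \<open>(c - c / 2) * n\<^sup>2\<close>, and the entropy differs from that sum by
  \<open>O(n)\<close>. Division by \<open>X\<^sup>2\<close> gives
  \<open>(c / 2) / c\<^sup>2\<close>.\<close>

theorem entropy_function_class_limit:
  assumes a: "\<And>k. 1 \<le> k \<Longrightarrow> 0 < a k \<and> a k \<le> 1"
    and c: "0 < c" and lim: "(\<lambda>k. - log 2 (weight a k) / real k) \<longlonglongrightarrow> c"
  shows "((\<lambda>\<epsilon>. entropy \<epsilon> (function_class a) / (log 2 (1 / \<epsilon>))\<^sup>2) \<longlongrightarrow> 1 / (2 * c)) (at_right 0)"
proof -
  define L where "L k = - log 2 (weight a k)" for k
  have L: "(\<lambda>k. L k / real k) \<longlonglongrightarrow> c" using lim by (simp add: L_def)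
  have w_pos: "0 < weight a k" for k
    unfolding weight_def using a by (intro prod_pos) auto
  \<comment> \<open>At \<open>k = 0\<close> both products are empty, so the value \<open>a 0\<close>
    does not enter.\<close>
  have "weight a (Suc k) \<le> weight a k" for k
  proof (cases k)
    case (Suc j)
    then have "weight a (Suc k) = weight a k * a k" by (simp add: weight_def)
    then show ?thesis using a[of k] w_pos[of k] Suc by (simp add: mult_left_le)
  qed (simp add: weight_def)
  then have w_anti: "weight a j \<le> weight a k" if "k \<le> j" for j k
    using that by (rule lift_Suc_antimono_le)
  have "filterlim L at_top sequentially"
  proof -
    have "filterlim (\<lambda>k. L k / real k * real k) at_top sequentially"
      by (rule filterlim_tendsto_pos_mult_at_top[OF L c filterlim_real_sequentially])
    then show ?thesis
      by (rule filterlim_mono_eventually[OF _ order_refl order_refl])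
         (use eventually_gt_at_top[of 0] in eventually_elim, simp)
  qed
  then have ex: "\<exists>k. weight a (Suc k) < \<epsilon>" if \<epsilon>: "0 < \<epsilon>" for \<epsilon>
  proof -
    assume "filterlim L at_top sequentially"
    then have "\<forall>\<^sub>F k in sequentially. - log 2 \<epsilon> < L k"
      by (simp add: filterlim_at_top_dense)
    then have "\<forall>\<^sub>F k in sequentially. - log 2 \<epsilon> < L (Suc k)"
      by (subst eventually_sequentially_Suc)
    then obtain k where "- log 2 \<epsilon> < L (Suc k)"
      by (auto simp: eventually_sequentially)
    then show ?thesis using \<epsilon> w_pos by (auto simp: L_def)
  qed
  \<comment> \<open>The shift by \<open>Suc\<close> makes \<open>n \<epsilon>\<close> the last index
    whose weight is at least \<open>\<epsilon>\<close>, or \<open>0\<close> if there is none from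
    \<open>1\<close> on.\<close>
  define n where "n \<epsilon> = (LEAST k. weight a (Suc k) < \<epsilon>)" for \<epsilon>
  have n_below: "weight a (Suc (n \<epsilon>)) < \<epsilon>" if "0 < \<epsilon>" for \<epsilon>
    unfolding n_def by (rule LeastI_ex[OF ex[OF that]])
  have n_above: "\<epsilon> \<le> weight a k" if "k \<in> {1..n \<epsilon>}" for \<epsilon> k
    using not_less_Least[of "k - 1" "\<lambda>k. weight a (Suc k) < \<epsilon>"] that by (fastforce simp: n_def)
  have pos: "\<forall>\<^sub>F \<epsilon> in at_right 0. (0::real) < \<epsilon>"
    by (rule eventually_at_right_less)
  have n_top: "filterlim n at_top (at_right 0)"
    unfolding filterlim_at_top
  proof
    fix N
    have "\<forall>\<^sub>F \<epsilon> in at_right 0. \<epsilon> < weight a N"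
      using w_pos by (intro order_tendstoD(2)[OF tendsto_ident_at]) auto
    with pos show "\<forall>\<^sub>F \<epsilon> in at_right 0. N \<le> n \<epsilon>"
    proof eventually_elim
      case (elim \<epsilon>)
      show ?case
      proof (rule ccontr)
        assume "\<not> N \<le> n \<epsilon>"
        then have "weight a N \<le> weight a (Suc (n \<epsilon>))" by (intro w_anti) auto
        then show False using n_below[OF elim(1)] elim(2) by linarith
      qed
    qed
  qed
  have n_pos: "\<forall>\<^sub>F \<epsilon> in at_right 0. 0 < n \<epsilon>"
    using n_top[unfolded filterlim_at_top, rule_format, of 1] by eventually_elim simp
  define X where "X \<epsilon> = log 2 (1 / \<epsilon>)" for \<epsilon> :: real
  \<comment> \<open>By the choice of \<open>n\<close>, \<open>X\<close> lies between
    \<open>L n\<close> and \<open>L (Suc n)\<close>; the factor \<open>1 + 1 / n\<close> replaces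
    the denominator \<open>Suc n\<close> by \<open>n\<close>.\<close>
  have ratio: "((\<lambda>\<epsilon>. X \<epsilon> / real (n \<epsilon>)) \<longlongrightarrow> c) (at_right 0)"
  proof (rule tendsto_sandwich)
    show "((\<lambda>\<epsilon>. L (n \<epsilon>) / real (n \<epsilon>)) \<longlongrightarrow> c) (at_right 0)"
      by (rule filterlim_compose[OF L n_top])
    have "(\<lambda>k. L (Suc k) / real (Suc k) * (1 + 1 / real k)) \<longlonglongrightarrow> c * (1 + 0)"
      by (intro tendsto_intros lim_1_over_n LIMSEQ_Suc[OF L])
    from filterlim_compose[OF this n_top]
    show "((\<lambda>\<epsilon>. L (Suc (n \<epsilon>)) / real (Suc (n \<epsilon>)) * (1 + 1 / real (n \<epsilon>))) \<longlongrightarrow> c) (at_right 0)"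
      by simp
    show "\<forall>\<^sub>F \<epsilon> in at_right 0. L (n \<epsilon>) / real (n \<epsilon>) \<le> X \<epsilon> / real (n \<epsilon>)"
      using pos n_pos
    proof eventually_elim
      case (elim \<epsilon>)
      then have "\<epsilon> \<le> weight a (n \<epsilon>)" by (intro n_above) auto
      then have "L (n \<epsilon>) \<le> X \<epsilon>"
        using elim w_pos by (simp add: L_def X_def log_divide)
      then show ?case by (intro divide_right_mono) auto
    qed
    show "\<forall>\<^sub>F \<epsilon> in at_right 0.
        X \<epsilon> / real (n \<epsilon>) \<le> L (Suc (n \<epsilon>)) / real (Suc (n \<epsilon>)) * (1 + 1 / real (n \<epsilon>))"
      using pos n_pos
    proof eventually_elim
      case (elim \<epsilon>)
      have "X \<epsilon> \<le> L (Suc (n \<epsilon>))"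
        using n_below[OF elim(1)] elim w_pos by (simp add: L_def X_def log_divide)
      then have "X \<epsilon> / real (n \<epsilon>) \<le> L (Suc (n \<epsilon>)) / real (n \<epsilon>)"
        by (intro divide_right_mono) auto
      also have "\<dots> = L (Suc (n \<epsilon>)) / real (Suc (n \<epsilon>)) * (1 + 1 / real (n \<epsilon>))"
        using elim(2) by (simp add: divide_simps)
      finally show ?case .
    qed
  qed
  define S where "S \<epsilon> = (\<Sum>k\<in>{1..n \<epsilon>}. X \<epsilon> - L k)" for \<epsilon>
  have S_lim: "((\<lambda>\<epsilon>. S \<epsilon> / (real (n \<epsilon>))\<^sup>2) \<longlongrightarrow> c - c / 2) (at_right 0)"
  proof (rule Lim_transform_eventually)
    show "((\<lambda>\<epsilon>. X \<epsilon> / real (n \<epsilon>) - (\<Sum>k\<in>{1..n \<epsilon>}. L k) / (real (n \<epsilon>))\<^sup>2) \<longlongrightarrow> c - c / 2) (at_right 0)"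
      by (intro tendsto_diff ratio filterlim_compose[OF sum_asymptotically_linear[OF L] n_top])
    show "\<forall>\<^sub>F \<epsilon> in at_right 0. X \<epsilon> / real (n \<epsilon>) - (\<Sum>k\<in>{1..n \<epsilon>}. L k) / (real (n \<epsilon>))\<^sup>2 = S \<epsilon> / (real (n \<epsilon>))\<^sup>2"
      using n_pos
      by eventually_elim (simp add: S_def sum_subtractf diff_divide_distrib power2_eq_square)
  qed
  define E where "E \<epsilon> = entropy \<epsilon> (function_class a)" for \<epsilon>
  have E_S: "\<forall>\<^sub>F \<epsilon> in at_right 0. \<bar>E \<epsilon> - S \<epsilon>\<bar> \<le> 2 * real (n \<epsilon>)"
    using pos
  proof eventually_elim
    case (elim \<epsilon>)
    have "weight a k \<le> \<epsilon>" if "n \<epsilon> < k" for k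
      using w_anti[of "Suc (n \<epsilon>)" k] n_below[OF elim] that by simp
    from entropy_function_class_bounds[OF elim w_pos this n_above, where n = "n \<epsilon>"]
    show ?case by (simp add: E_def S_def L_def X_def)
  qed
  \<comment> \<open>An error of two bits per level is linear in \<open>n\<close>, hence negligible
    against \<open>n\<^sup>2\<close>.\<close>
  have "((\<lambda>\<epsilon>. (E \<epsilon> - S \<epsilon>) / (real (n \<epsilon>))\<^sup>2) \<longlongrightarrow> 0) (at_right 0)"
  proof (rule Lim_null_comparison)
    have "(\<lambda>k. 2 * (1 / real k)) \<longlonglongrightarrow> 2 * 0"
      by (intro tendsto_intros lim_1_over_n)
    from filterlim_compose[OF this n_top]
    show "((\<lambda>\<epsilon>. 2 * (1 / real (n \<epsilon>))) \<longlongrightarrow> 0) (at_right 0)" by simp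
    show "\<forall>\<^sub>F \<epsilon> in at_right 0. norm ((E \<epsilon> - S \<epsilon>) / (real (n \<epsilon>))\<^sup>2) \<le> 2 * (1 / real (n \<epsilon>))"
      using E_S n_pos by eventually_elim (simp add: divide_simps power2_eq_square)
  qed
  then have "((\<lambda>\<epsilon>. ((E \<epsilon> - S \<epsilon>) / (real (n \<epsilon>))\<^sup>2 + S \<epsilon> / (real (n \<epsilon>))\<^sup>2) / (X \<epsilon> / real (n \<epsilon>))\<^sup>2)
      \<longlongrightarrow> (0 + (c - c / 2)) / c\<^sup>2) (at_right 0)"
    using c by (intro tendsto_intros S_lim ratio) auto
  moreover have "(0 + (c - c / 2)) / c\<^sup>2 = 1 / (2 * c)"
    using c by (simp add: field_simps power2_eq_square)
  moreover have "\<forall>\<^sub>F \<epsilon> in at_right 0.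
      ((E \<epsilon> - S \<epsilon>) / (real (n \<epsilon>))\<^sup>2 + S \<epsilon> / (real (n \<epsilon>))\<^sup>2) / (X \<epsilon> / real (n \<epsilon>))\<^sup>2 = E \<epsilon> / (X \<epsilon>)\<^sup>2"
    using n_pos by eventually_elim (simp add: power_divide flip: add_divide_distrib)
  ultimately show ?thesis
    unfolding E_def X_def by (auto intro: Lim_transform_eventually)
qed

subsection \<open>The two clocks\<close>

text \<open>
  A run of length about \<open>sqrt r\<close> starts at every square \<open>r\<^sup>2\<close>: the runs are arbitrarily long,
  but only \<open>O(n powr (3/4))\<close> indices below \<open>n\<close> lie in a run.
\<close>

definition in_run :: "nat \<Rightarrow> bool" where
  "in_run k \<longleftrightarrow> (k - (floor_sqrt k)\<^sup>2)\<^sup>2 \<le> floor_sqrt k"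

text \<open>The run at the square of \<open>r = (m + 1)\<^sup>2\<close> has room for all offsets
  \<open>i < m\<close>: \<open>i\<^sup>2 \<le> r\<close>, and \<open>i \<le> r\<close> keeps the
  index below the next square.\<close>

lemma in_run_run:
  assumes "i < m"
  shows "in_run ((Suc m ^ 2)\<^sup>2 + i)"
proof -
  define r where "r = Suc m ^ 2"
  have ir: "i\<^sup>2 \<le> r" "i \<le> r"
    using assms power_mono[of i "Suc m" 2] unfolding r_def by (auto simp: power2_eq_square)
  have "floor_sqrt (r\<^sup>2 + i) = r"
  proof (rule floor_sqrt_unique)
    show "r\<^sup>2 \<le> r\<^sup>2 + i" by simp
    show "r\<^sup>2 + i < (Suc r)\<^sup>2" using ir(2) by (simp add: power2_eq_square)
  qed
  then show ?thesis
    unfolding in_run_def r_def[symmetric] using ir(1) by simp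
qed

text \<open>An index is determined by its integer root and its offset from the square of that root.
  Inside a run these are at most the square root and the fourth root of \<open>n\<close>.\<close>

lemma card_in_run_le:
  "real (card {i \<in> {1..<n}. in_run i}) \<le> (sqrt n + 1) * (sqrt (sqrt n) + 1)"
proof -
  define R where "R = floor_sqrt n"
  define Q where "Q = floor_sqrt R"
  let ?f = "\<lambda>k. (floor_sqrt k, k - (floor_sqrt k)\<^sup>2)"
  have inj: "inj_on ?f {i \<in> {1..<n}. in_run i}"
    by (rule inj_onI) (metis floor_sqrt_power2_le le_add_diff_inverse prod.inject)
  have sub: "?f ` {i \<in> {1..<n}. in_run i} \<subseteq> {..R} \<times> {..Q}"
  proof clarify
    fix k assume k: "k \<in> {1..<n}" "in_run k"
    have 1: "floor_sqrt k \<le> R"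
      using k unfolding R_def by (intro monoD[OF mono_floor_sqrt]) auto
    have "k - (floor_sqrt k)\<^sup>2 \<le> floor_sqrt (floor_sqrt k)"
      using k(2) unfolding in_run_def by (simp add: le_floor_sqrt_iff)
    also have "\<dots> \<le> Q"
      unfolding Q_def by (rule monoD[OF mono_floor_sqrt 1])
    finally show "floor_sqrt k \<in> {..R} \<and> k - (floor_sqrt k)\<^sup>2 \<in> {..Q}"
      using 1 by simp
  qed
  have "card {i \<in> {1..<n}. in_run i} \<le> card ({..R} \<times> {..Q})"
    by (rule card_inj_on_le[OF inj sub]) simp
  then have "real (card {i \<in> {1..<n}. in_run i}) \<le> (real R + 1) * (real Q + 1)"
    by (simp add: algebra_simps) (metis of_nat_Suc of_nat_add of_nat_le_iff of_nat_mult)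
  also have "\<dots> \<le> (sqrt n + 1) * (sqrt (sqrt n) + 1)"
  proof -
    have le: "real (floor_sqrt j) \<le> sqrt j" for j
      by (rule real_le_rsqrt) (metis floor_sqrt_power2_le of_nat_le_iff of_nat_power)
    have "real Q \<le> sqrt R" unfolding Q_def by (rule le)
    also have "\<dots> \<le> sqrt (sqrt n)" using le[of n] unfolding R_def by simp
    finally show ?thesis
      using le[of n] unfolding R_def[symmetric] by (intro mult_mono) auto
  qed
  finally show ?thesis .
qed

lemma density_in_run: "(\<lambda>n. real (card {i \<in> {1..<n}. in_run i}) / real n) \<longlonglongrightarrow> 0"
proof (rule tendsto_sandwich[OF _ _ tendsto_const])
  show "\<forall>\<^sub>F n in sequentially. 0 \<le> real (card {i \<in> {1..<n}. in_run i}) / real n"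
    by simp
  show "\<forall>\<^sub>F n in sequentially. real (card {i \<in> {1..<n}. in_run i}) / real n \<le>
      (sqrt n + 1) * (sqrt (sqrt n) + 1) / real n"
    by (intro always_eventually allI divide_right_mono card_in_run_le) simp
  show "(\<lambda>n. (sqrt (real n) + 1) * (sqrt (sqrt (real n)) + 1) / real n) \<longlonglongrightarrow> 0"
    by real_asymp
qed

text \<open>Replacing \<open>\<beta>\<close> by \<open>\<alpha>\<close> on the indices in
  \<open>R\<close> changes the logarithm by a constant times their number, which is
  \<open>o(n)\<close>; so only \<open>\<beta>\<close> survives in the mean.\<close>

lemma mean_log_weight_limit:
  fixes \<alpha> \<beta> :: real
  assumes pos: "0 < \<alpha>" "0 < \<beta>"
    and a: "\<And>k. 1 \<le> k \<Longrightarrow> a k = (if R k then \<alpha> else \<beta>)"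
    and density: "(\<lambda>n. real (card {i \<in> {1..<n}. R i}) / real n) \<longlonglongrightarrow> 0"
  shows "(\<lambda>k. - log 2 (weight a k) / real k) \<longlonglongrightarrow> - log 2 \<beta>"
proof -
  define d where "d n = real (card {i \<in> {1..<n}. R i})" for n
  have eq: "- log 2 (weight a n) / real n =
      - log 2 \<beta> * (1 - 1 / real n) - (log 2 \<alpha> - log 2 \<beta>) * (d n / real n)" if n: "1 \<le> n" for n
  proof -
    have "log 2 (weight a n) = (\<Sum>i\<in>{1..<n}. log 2 (a i))"
      unfolding weight_def using pos a
      by (intro log_prod_pos) auto
    also have "\<dots> = (\<Sum>i\<in>{1..<n}. log 2 \<beta> + (if R i then log 2 \<alpha> - log 2 \<beta> else 0))"
      using a by (intro sum.cong) auto
    \<comment> \<open>\<open>weight a n\<close> has only \<open>n - 1\<close> factors.\<close>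
    also have "\<dots> = log 2 \<beta> * (real n - 1) + (log 2 \<alpha> - log 2 \<beta>) * d n"
      using n by (simp add: sum.distrib d_def of_nat_diff flip: sum.inter_filter)
    finally have "- log 2 (weight a n) / real n =
        (- log 2 \<beta> * (real n - 1) - (log 2 \<alpha> - log 2 \<beta>) * d n) / real n" by simp
    then show ?thesis
      using n by (simp add: diff_divide_distrib right_diff_distrib)
  qed
  have "(\<lambda>n. - log 2 \<beta> * (1 - 1 / real n) - (log 2 \<alpha> - log 2 \<beta>) * (d n / real n))
      \<longlonglongrightarrow> - log 2 \<beta> * (1 - 0) - (log 2 \<alpha> - log 2 \<beta>) * 0"
    using density unfolding d_def[symmetric] by (intro tendsto_intros lim_1_over_n)
  then have "(\<lambda>n. - log 2 \<beta> * (1 - 1 / real n) - (log 2 \<alpha> - log 2 \<beta>) * (d n / real n))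
      \<longlonglongrightarrow> - log 2 \<beta>"
    by simp
  moreover have "\<forall>\<^sub>F n in sequentially.
      - log 2 \<beta> * (1 - 1 / real n) - (log 2 \<alpha> - log 2 \<beta>) * (d n / real n) =
      - log 2 (weight a n) / real n"
    using eventually_ge_at_top[of 1] by eventually_elim (rule eq[symmetric])
  ultimately show ?thesis by (rule Lim_transform_eventually)
qed

lemma entropy_limit_two_valued_clock:
  fixes \<alpha> \<beta> :: real
  assumes \<alpha>: "0 < \<alpha>" "\<alpha> \<le> 1" and \<beta>: "0 < \<beta>" "\<beta> < 1"
    and a: "\<And>k. 1 \<le> k \<Longrightarrow> a k = (if R k then \<alpha> else \<beta>)"
    and density: "(\<lambda>n. real (card {i \<in> {1..<n}. R i}) / real n) \<longlonglongrightarrow> 0"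
  shows "((\<lambda>\<epsilon>. entropy \<epsilon> (function_class a) / (log 2 (1 / \<epsilon>))\<^sup>2)
    \<longlongrightarrow> 1 / (2 * log 2 (1 / \<beta>))) (at_right 0)"
proof -
  have "- log 2 \<beta> = log 2 (1 / \<beta>)" using \<beta> by (simp add: log_divide)
  moreover have "0 < log 2 (1 / \<beta>)" using \<beta> by simp
  ultimately show ?thesis
    using mean_log_weight_limit[OF \<alpha>(1) \<beta>(1) a density] \<alpha> \<beta> a
    by (intro entropy_function_class_limit) auto
qed

text \<open>With truncated subtraction \<open>1 - (x - s)\<close> is \<open>1\<close> if
  \<open>x \<le> s\<close> and \<open>0\<close> otherwise, so the numerator is \<open>9\<close> on
  runs and \<open>6\<close> elsewhere. The case distinction is thus arithmetical, built from
  operations already shown computable.\<close>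

definition sparse_run_clock :: "nat \<Rightarrow> rat" where
  "sparse_run_clock k =
    of_nat (6 + 3 * (1 - ((k - (floor_sqrt k)\<^sup>2)\<^sup>2 - floor_sqrt k))) / of_nat 10"

lemma sparse_run_clock_eq: "sparse_run_clock k = (if in_run k then 9 / 10 else 3 / 5)"
  unfolding sparse_run_clock_def in_run_def by (auto simp: not_le)

lemma of_rat_sparse_run_clock: "real_of_rat (sparse_run_clock k) = (if in_run k then 9 / 10 else 3 / 5)"
  by (simp add: sparse_run_clock_eq of_rat_divide)

lemma computable_sparse_run_clock: "computable_rat_seq sparse_run_clock"
  unfolding sparse_run_clock_def[abs_def] power2_eq_square
  by (intro computable_rat_seq_quotient computes_add computes_mult computes_diff computes_const
      computes_floor_sqrt computes_proj) auto

theorem corollary4p4: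
  "\<exists>a1 a2 :: nat \<Rightarrow> rat.
     computable_rat_seq a1 \<and> computable_rat_seq a2 \<and>
     (\<exists>lo hi :: real. 1 / 2 < lo \<and> lo \<le> hi \<and> hi < 1 \<and> (\<forall>k\<ge>1. of_rat (a1 k) \<in> {lo..hi})) \<and>
     (\<exists>lo hi :: real. 1 / 2 < lo \<and> lo \<le> hi \<and> hi < 1 \<and> (\<forall>k\<ge>1. of_rat (a2 k) \<in> {lo..hi})) \<and>
     has_chronological_radius (\<lambda>k. of_rat (a1 k)) (9 / 10) \<and>
     has_chronological_radius (\<lambda>k. of_rat (a2 k)) (9 / 10) \<and>
     ((\<lambda>\<epsilon>. entropy \<epsilon> (function_class (\<lambda>k. of_rat (a1 k))) / (log 2 (1 / \<epsilon>))\<^sup>2)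
        \<longlongrightarrow> 1 / (2 * log 2 (10 / 9))) (at_right 0) \<and>
     ((\<lambda>\<epsilon>. entropy \<epsilon> (function_class (\<lambda>k. of_rat (a2 k))) / (log 2 (1 / \<epsilon>))\<^sup>2)
        \<longlongrightarrow> 1 / (2 * log 2 (5 / 3))) (at_right 0) \<and>
     1 / (2 * log 2 (10 / 9)) \<noteq> 1 / (2 * log 2 (5 / 3 :: real))"
proof (rule exI[of _ "\<lambda>k. 9 / 10"], rule exI[of _ sparse_run_clock], intro conjI)
  let ?a1 = "\<lambda>k::nat. real_of_rat (9 / 10)" and ?a2 = "\<lambda>k. real_of_rat (sparse_run_clock k)"
  have a1: "?a1 k = 9 / 10" for k by (simp add: of_rat_divide)
  show "computable_rat_seq (\<lambda>k. 9 / 10)"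
    using computable_rat_seq_quotient[of "\<lambda>_. 9" "\<lambda>_. 10"] by (simp add: computes_const)
  show "computable_rat_seq sparse_run_clock"
    by (rule computable_sparse_run_clock)
  show "\<exists>lo hi :: real. 1 / 2 < lo \<and> lo \<le> hi \<and> hi < 1 \<and> (\<forall>k\<ge>1::nat. ?a1 k \<in> {lo..hi})"
    unfolding a1 by (intro exI[of _ "9 / 10"]) simp
  show "\<exists>lo hi :: real. 1 / 2 < lo \<and> lo \<le> hi \<and> hi < 1 \<and> (\<forall>k\<ge>1. ?a2 k \<in> {lo..hi})"
    unfolding of_rat_sparse_run_clock by (intro exI[of _ "3 / 5"] exI[of _ "9 / 10"]) simp
  show "has_chronological_radius ?a1 (9 / 10)"
    unfolding a1 by (rule has_chronological_radius_of_runs) auto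
  show "has_chronological_radius ?a2 (9 / 10)"
  proof (rule has_chronological_radius_of_runs)
    fix m
    show "\<exists>b\<ge>1. \<forall>i<m. ?a2 (b + i) = 9 / 10"
      \<comment> \<open>Runs of every length occur, the one for \<open>m\<close> starting at the
        fourth power of \<open>m + 1\<close>.\<close>
      using in_run_run by (intro exI[of _ "(Suc m ^ 2)\<^sup>2"]) (simp add: of_rat_sparse_run_clock)
  qed (simp add: of_rat_sparse_run_clock)
  show "((\<lambda>\<epsilon>. entropy \<epsilon> (function_class ?a1) / (log 2 (1 / \<epsilon>))\<^sup>2)
      \<longlongrightarrow> 1 / (2 * log 2 (10 / 9))) (at_right 0)"
    \<comment> \<open>The constant clock is the two-valued one with an empty exceptional
      set.\<close>
    using entropy_limit_two_valued_clock[of "9 / 10" "9 / 10" ?a1 "\<lambda>_. False"] by (simp add: a1)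
  show "((\<lambda>\<epsilon>. entropy \<epsilon> (function_class ?a2) / (log 2 (1 / \<epsilon>))\<^sup>2)
      \<longlongrightarrow> 1 / (2 * log 2 (5 / 3))) (at_right 0)"
    using entropy_limit_two_valued_clock[of "9 / 10" "3 / 5" ?a2 in_run, OF _ _ _ _ _ density_in_run]
    by (simp add: of_rat_sparse_run_clock)
  have "log 2 (10 / 9) < log 2 (5 / 3 :: real)" by simp
  then have "log 2 (10 / 9) \<noteq> log 2 (5 / 3 :: real)" by (rule less_imp_neq)
  then show "1 / (2 * log 2 (10 / 9)) \<noteq> 1 / (2 * log 2 (5 / 3 :: real))"
    by simp
qed

end
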